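(* Let $2\le k\le n-1$ and let $\gamma_k\in(0,1)$ be as specified in the context. There exist $0<\delta_0<1$, depending only on $k,n,\gamma_k$, and $C_{10}>0$, depending only on $k,n,\gamma_k,\delta_0$ and not on $\mu$, such that for all $\mu>0$, all $\delta$ with $0<\delta\le\delta_0$, all $R\in D_{\delta,\mu,\gamma_k}$ and all $P\in\mathbb{R}^{n\times n}$ with $P^T=P$, $$d^2F_k(R,P)\le -C_{10}\,|\tilde{\tilde P}|^2 .$$
   Context: For $R\in\mathbb{R}^{n\times n}$, $S_k(R)=\sigma_k(\lambda(R))$, where $\lambda(R)\in\mathbb{C}^n$ is the vector of eigenvalues of $R$ and $\sigma_k(\lambda)=\sum_{1\le i_1<\cdots<i_k\le n}\lambda_{i_1}\cdots\lambda_{i_k}$; equivalently $S_k(R)$ is the sum of all $k\times k$ principal minors of $R$. $F_k(R)=\log S_k(R)$, and for $M\in\mathbb{R}^{n\times n}$, $d^2F_k(R,M)=\sum_{i,j,\ell,m=1}^n\frac{\partial^2F_k(R)}{\partial R_{ij}\partial R_{\ell m}}M_{ij}M_{\ell m}$. $|M|=(\sum_{i,j}M_{ij}^2)^{1/2}$, $\|\cdot\|$ is the operator norm, $\lambda_{\min}(\omega)$ is the least eigenvalue of $\omega$. For $0\le\delta<1$, $\mu\ge0$: $D_{\delta,\mu}$ is the set of $R=\omega+\beta\in\mathbb{R}^{n\times n}$ with $\omega^T=\omega>0$, $\beta^T=-\beta$, $\|\beta\|\le\mu$ and $\mu\le\delta\lambda_{\min}(\omega)$. $\Gamma_n=\{\lambda\in\mathbb{R}^n:\lambda_j>0,\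 j=1,\dots,n\}$. $\Sigma_{(\gamma_k)}$ is the set of $\lambda\in\Gamma_n$ with $\min_j\lambda_j\ge\gamma_k\max_j\lambda_j$, where: (i) if $k\in\{2,3,4,n-2,n-1\}$, $\gamma_k$ is some fixed number in $(0,1)$; (ii) if $[\frac n2]+1\le k\le n-3$, $\gamma_k=\frac{n-k}{k}$; (iii) if $5\le k\le[\frac n2]$, $\gamma_k=\frac{k-2}{n-(k-2)}$. For $0<\delta<1$, $\mu>0$: $D_{\delta,\mu,\gamma_k}=\{R=\omega+\beta\in D_{\delta,\mu}:\lambda(\omega)\in\Sigma_{(\gamma_k)}\}$. For $R=\omega+\beta\in D_{\delta,\mu}$ write $\omega=C^{-1}DC$ with $C$ orthogonal and $D=\mathrm{diag}(\lambda_1,\dots,\lambda_n)$, and set $\widetilde P=CPC^{-1}$, $\tilde{\tilde P}=D^{-1/2}\widetilde PD^{-1/2}$. *)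

theory Defs
  imports "HOL-Analysis.Analysis" "HOL-Computational_Algebra.Polynomial"
begin

text \<open>
  The size n is \<open>CARD('n)\<close>. On \<open>real^'n^'n\<close> the library's \<open>norm\<close> is the Euclidean norm of
  the vector of all entries, so it is the norm \<open>|M|\<close>; the operator norm of \<open>\<beta>\<close> is
  \<open>onorm ((*v) \<beta>)\<close>.
\<close>

definition charpoly :: "real^'n^'n \<Rightarrow> complex poly" where
  "charpoly R =
     det (\<chi> i j. (if i = j then [:0, 1:] else 0) - [:complex_of_real (R $ i $ j):])"

text \<open>
  The vector of eigenvalues, listed with algebraic multiplicity. The order of the list is left
  to the choice operator; everything below is invariant under permutation of the entries.
\<close>

definition eigvals :: "real^'n^'n \<Rightarrow> complex^'n" where
  "eigvals R = (SOME v. charpoly R = (\<Prod>i\<in>UNIV. [:- (v $ i), 1:]))"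

definition sigma :: "nat \<Rightarrow> 'a::comm_ring_1^'n \<Rightarrow> 'a" where
  "sigma k v = (\<Sum>I | I \<subseteq> UNIV \<and> card I = k. \<Prod>i\<in>I. v $ i)"

text \<open>
  The nonreal eigenvalues of a real matrix come in conjugate pairs, so \<open>sigma k (eigvals R)\<close>
  is real and \<open>Re\<close> only changes its type.
\<close>

definition S :: "nat \<Rightarrow> real^'n^'n \<Rightarrow> real" where
  "S k R = Re (sigma k (eigvals R))"

definition F :: "nat \<Rightarrow> real^'n^'n \<Rightarrow> real" where
  "F k R = ln (S k R)"

definition entry_deriv :: "'n \<Rightarrow> 'n \<Rightarrow> (real^'n^'n \<Rightarrow> real) \<Rightarrow> real^'n^'n \<Rightarrow> real" where
  "entry_deriv i j f R = deriv (\<lambda>t. f (R + t *\<^sub>R axis i (axis j 1))) 0"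

definition d2F :: "nat \<Rightarrow> real^'n^'n \<Rightarrow> real^'n^'n \<Rightarrow> real" where
  "d2F k R M =
     (\<Sum>i\<in>UNIV. \<Sum>j\<in>UNIV. \<Sum>l\<in>UNIV. \<Sum>m\<in>UNIV.
        entry_deriv i j (entry_deriv l m (F k)) R * M $ i $ j * M $ l $ m)"

text \<open>Used for symmetric matrices only, whose eigenvalues are real.\<close>

definition lambda_min :: "real^'n^'n \<Rightarrow> real" where
  "lambda_min \<omega> = Min (range (\<lambda>j. Re (eigvals \<omega> $ j)))"

definition pos_def :: "real^'n^'n \<Rightarrow> bool" where
  "pos_def \<omega> \<longleftrightarrow> (\<forall>x. x \<noteq> 0 \<longrightarrow> 0 < x \<bullet> (\<omega> *v x))"

definition D_set :: "real \<Rightarrow> real \<Rightarrow> (real^'n^'n) set" where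
  "D_set \<delta> \<mu> =
     {\<omega> + \<beta> | \<omega> \<beta>. transpose \<omega> = \<omega> \<and> pos_def \<omega> \<and> transpose \<beta> = - \<beta> \<and>
                onorm ((*v) \<beta>) \<le> \<mu> \<and> \<mu> \<le> \<delta> * lambda_min \<omega>}"

definition Gamma_cone :: "(real^'n) set" where
  "Gamma_cone = {l. \<forall>j. 0 < l $ j}"

definition Sigma_cone :: "real \<Rightarrow> (real^'n) set" where
  "Sigma_cone \<gamma> =
     {l \<in> Gamma_cone. Min (range (\<lambda>j. l $ j)) \<ge> \<gamma> * Max (range (\<lambda>j. l $ j))}"

text \<open>
  The values of \<open>\<gamma>\<close> allowed for given n and k. For n = 7, k = 4 the first two cases overlap, and
  the value in the second is one of those allowed by the first.
\<close>

definition gamma_admissible :: "nat \<Rightarrow> nat \<Rightarrow> real \<Rightarrow> bool" where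
  "gamma_admissible n k \<gamma> \<longleftrightarrow>
     k \<in> {2, 3, 4, n - 2, n - 1} \<and> 0 < \<gamma> \<and> \<gamma> < 1 \<or>
     n div 2 + 1 \<le> k \<and> k + 3 \<le> n \<and> \<gamma> = (real n - real k) / real k \<or>
     5 \<le> k \<and> k \<le> n div 2 \<and> \<gamma> = (real k - 2) / (real n - (real k - 2))"

definition D_gamma_set :: "real \<Rightarrow> real \<Rightarrow> real \<Rightarrow> (real^'n^'n) set" where
  "D_gamma_set \<delta> \<mu> \<gamma> =
     {\<omega> + \<beta> | \<omega> \<beta>. transpose \<omega> = \<omega> \<and> transpose \<beta> = - \<beta> \<and> \<omega> + \<beta> \<in> D_set \<delta> \<mu> \<and>
                (\<exists>l \<in> Sigma_cone \<gamma>. eigvals \<omega> = (\<chi> j. complex_of_real (l $ j)))}"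

definition diag :: "real^'n \<Rightarrow> real^'n^'n" where
  "diag d = (\<chi> i j. if i = j then d $ i else 0)"

definition P_tilde :: "real^'n^'n \<Rightarrow> real^'n^'n \<Rightarrow> real^'n^'n" where
  "P_tilde C P = C ** P ** matrix_inv C"

text \<open>The argument \<open>l\<close> is the diagonal of D.\<close>

definition P_tilde2 :: "real^'n^'n \<Rightarrow> real^'n \<Rightarrow> real^'n^'n \<Rightarrow> real^'n^'n" where
  "P_tilde2 C l P =
     diag (\<chi> j. l $ j powr (-1/2)) ** P_tilde C P ** diag (\<chi> j. l $ j powr (-1/2))"

end

theory Submission
  imports Defs "HOL-Computational_Algebra.Fundamental_Theorem_Algebra"
begin

text \<open>
  At a positive definite \<open>\<omega>\<close>, the function \<open>F k = log S_k\<close> is strictly concave in symmetric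
  directions when \<open>k \<ge> 2\<close>, and the theorem is a uniform version of this fact. Conjugation by the orthogonal \<open>C\<close>
  and division by the largest eigenvalue reduce it to \<open>R = diag l + B\<close> with \<open>\<gamma> \<le> l_j \<le> 1\<close> and
  \<open>B\<close> small, and to symmetric directions \<open>P\<close> of norm one. For \<open>B = 0\<close> such pairs form a
  compact set, on which \<open>S_k\<close> is positive and \<open>d2F k\<close> is continuous. So negativity for \<open>B = 0\<close> gives
  both a uniform negative upper bound and a radius for \<open>B\<close> that keeps half of it
  (\<open>newton_form_uniformly_neg\<close>). Since \<open>B\<close> has norm at most a multiple of \<open>\<delta>\<close>, the
  radius determines \<open>\<delta>\<^sub>0\<close>, and \<open>\<mu>\<close> disappears in the scaling.

  It remains to see that \<open>t \<mapsto> log S_k (diag l + t P)\<close> has a negative second derivative at \<open>0\<close>. As \<open>S_k\<close> is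
  the sum of the principal minors of size \<open>k\<close> (\<open>S_eq_sum_minors\<close>), this function is the logarithm of a polynomial whose
  coefficients are explicit (\<open>coeff_line_poly\<close>). Off-diagonal entries of \<open>P\<close> occur first in the quadratic
  coefficient, as the negative terms \<open>- P_ab\<^sup>2\<close> times products of eigenvalues. The diagonal of \<open>P\<close> leaves the
  elementary symmetric polynomial of the vector \<open>l + t p\<close>, and here strict log-concavity is needed.

  That comes from the theorem of Marcus and Lopes: the quotient of consecutive elementary symmetric
  polynomials is concave on the positive orthant (\<open>eratio_superadditive\<close>). The polynomial of degree \<open>k\<close> is the one
  of degree two times such quotients, so it is at least as log-concave as that one
  (\<open>esym_log_concavity_dominates\<close>), and the quadratic polynomial is strictly log-concave
  because its form has Lorentzian signature (\<open>esym_2_newton_strict\<close>).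
\<close>

section \<open>Elementary symmetric polynomials and their quotients\<close>

definition esym :: "nat \<Rightarrow> 'i set \<Rightarrow> ('i \<Rightarrow> 'a::comm_semiring_1) \<Rightarrow> 'a" where
  "esym k A a = (\<Sum>I | I \<subseteq> A \<and> card I = k. \<Prod>i\<in>I. a i)"

lemma esym_0 [simp]: "finite A \<Longrightarrow> esym 0 A a = 1"
proof -
  assume "finite A"
  then have "{I. I \<subseteq> A \<and> card I = 0} = {{}}" by (auto dest: finite_subset)
  then show ?thesis by (simp add: esym_def)
qed

lemma esym_cong: "(\<And>i. i \<in> A \<Longrightarrow> a i = b i) \<Longrightarrow> esym k A a = esym k A b"
  unfolding esym_def by (intro sum.cong prod.cong) auto

lemma esym_eq_0: "finite A \<Longrightarrow> card A < k \<Longrightarrow> esym k A a = 0"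
proof -
  assume "finite A" "card A < k"
  then have "{I. I \<subseteq> A \<and> card I = k} = {}" using card_mono[of A] leD by blast
  then show ?thesis by (simp only: esym_def sum.empty)
qed

lemma esym_insert:
  assumes "finite A" "x \<notin> A"
  shows "esym (Suc k) (insert x A) a = esym (Suc k) A a + a x * esym k A a"
proof -
  let ?U = "{I. I \<subseteq> A \<and> card I = Suc k}" and ?V = "{I. I \<subseteq> A \<and> card I = k}"
  have fin: "finite ?U" "finite ?V" using assms(1) by auto
  have eq: "{I. I \<subseteq> insert x A \<and> card I = Suc k} = ?U \<union> insert x ` ?V" (is "?L = ?R")
  proof (intro equalityI subsetI)
    fix I assume I: "I \<in> ?L"
    show "I \<in> ?R"
    proof (cases "x \<in> I")
      case True
      have "finite I" using I assms(1) finite_subset by auto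
      then have "I = insert x (I - {x})" "I - {x} \<in> ?V" using I True by auto
      then show ?thesis by blast
    qed (use I in auto)
  next
    fix I assume "I \<in> ?R"
    then consider "I \<in> ?U" | J where "J \<in> ?V" "I = insert x J" by blast
    then show "I \<in> ?L"
    proof cases
      case 2
      then have "finite J" "x \<notin> J" using assms finite_subset by auto
      then show ?thesis using 2 by auto
    qed auto
  qed
  have inj: "inj_on (insert x) ?V"
    by (rule inj_onI) (use assms(2) in \<open>metis (no_types, lifting) insert_ident mem_Collect_eq subsetD\<close>)
  have "esym (Suc k) (insert x A) a = (\<Sum>I\<in>?U. \<Prod>i\<in>I. a i) + (\<Sum>I\<in>insert x ` ?V. \<Prod>i\<in>I. a i)"
    unfolding esym_def eq using assms fin by (intro sum.union_disjoint) auto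
  also have "(\<Sum>I\<in>insert x ` ?V. \<Prod>i\<in>I. a i) = (\<Sum>I\<in>?V. a x * (\<Prod>i\<in>I. a i))"
    unfolding sum.reindex[OF inj] comp_def
    using assms by (intro sum.cong prod.insert refl) (auto dest: finite_subset)
  finally show ?thesis by (simp add: esym_def sum_distrib_left)
qed

lemma esym_remove:
  assumes "finite A" "x \<in> A"
  shows "esym (Suc k) A a = esym (Suc k) (A - {x}) a + a x * esym k (A - {x}) a"
  using esym_insert[of "A - {x}" x k a] assms by (simp add: insert_absorb)

lemma esym_1: "finite A \<Longrightarrow> esym (Suc 0) A a = (\<Sum>i\<in>A. a i)"
  by (induction rule: finite_induct) (auto simp: esym_insert esym_eq_0 add.commute)

text \<open>
  Each term of the right-hand side is a product over a set of size \<open>k + 1\<close> with one marked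
  element, and every such set can be marked in \<open>k + 1\<close> ways. This is Euler's identity for a
  homogeneous polynomial whose partial derivatives are \<open>esym k (A - {i})\<close>.
\<close>
lemma esym_euler:
  assumes "finite A"
  shows "of_nat (Suc k) * esym (Suc k) A a = (\<Sum>i\<in>A. a i * esym k (A - {i}) a)"
  using assms
proof (induction arbitrary: k rule: finite_induct)
  case empty
  then show ?case by (simp add: esym_eq_0)
next
  case (insert x A)
  have rem: "insert x A - {i} = insert x (A - {i})" if "i \<in> A" for i
    using insert.hyps that by auto
  have x: "insert x A - {x} = A" using insert.hyps by auto
  have "(\<Sum>i\<in>insert x A. a i * esym k (insert x A - {i}) a)
      = a x * esym k A a + (\<Sum>i\<in>A. a i * esym k (insert x (A - {i})) a)"
    using insert.hyps x rem by simp
  also have "(\<Sum>i\<in>A. a i * esym k (insert x (A - {i})) a)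
     = of_nat (Suc k) * esym (Suc k) A a + a x * (of_nat k * esym k A a)"
  proof (cases k)
    case 0
    then show ?thesis using insert by (simp add: esym_1)
  next
    case (Suc j)
    have "(\<Sum>i\<in>A. a i * esym k (insert x (A - {i})) a)
       = (\<Sum>i\<in>A. a i * esym k (A - {i}) a) + a x * (\<Sum>i\<in>A. a i * esym j (A - {i}) a)"
      using insert.hyps unfolding Suc
      by (simp add: esym_insert sum.distrib sum_distrib_left algebra_simps)
    then show ?thesis by (simp only: insert.IH Suc)
  qed
  finally show ?case using insert.hyps by (simp add: esym_insert algebra_simps)
qed

lemma esym_scale: "esym k A (\<lambda>i. c * a i) = c ^ k * esym k A a"
  unfolding esym_def sum_distrib_left by (intro sum.cong) (auto simp: prod.distrib)

lemma esym_nonneg: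
  fixes a :: "'i \<Rightarrow> real"
  shows "(\<And>i. i \<in> A \<Longrightarrow> 0 \<le> a i) \<Longrightarrow> 0 \<le> esym k A a"
  unfolding esym_def by (auto intro!: sum_nonneg prod_nonneg)

lemma esym_pos:
  fixes a :: "'i \<Rightarrow> real"
  assumes "finite A" "\<And>i. i \<in> A \<Longrightarrow> 0 < a i" "k \<le> card A"
  shows "0 < esym k A a"
proof -
  obtain I where "I \<subseteq> A" "card I = k" using assms(3) by (meson obtain_subset_with_card_n)
  then show ?thesis unfolding esym_def using assms
    by (intro sum_pos) (auto intro!: prod_pos)
qed

definition eratio :: "nat \<Rightarrow> 'i set \<Rightarrow> ('i \<Rightarrow> real) \<Rightarrow> real" where
  "eratio k A a = esym (Suc k) A a / esym k A a"

lemma eratio_nonneg: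
  "(\<And>i. i \<in> A \<Longrightarrow> 0 < a i) \<Longrightarrow> 0 \<le> eratio k A a"
  unfolding eratio_def by (intro divide_nonneg_nonneg esym_nonneg) (auto intro: less_imp_le)

text \<open>
  Euler's identity expresses the quotient on \<open>A\<close> by quotients of one degree less on the sets
  \<open>A - {i}\<close>. Each summand is half a harmonic mean, hence concave and increasing in
  both arguments, which is what lets superadditivity pass from \<open>k\<close> to \<open>k + 1\<close>.
\<close>
lemma eratio_rec:
  assumes "finite A" "\<And>i. i \<in> A \<Longrightarrow> 0 < a i" "Suc k \<le> card A"
  shows "real (Suc (Suc k)) * eratio (Suc k) A a
       = (\<Sum>i\<in>A. a i * eratio k (A - {i}) a / (a i + eratio k (A - {i}) a))"
proof -
  have "real (Suc (Suc k)) * eratio (Suc k) A a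
      = (\<Sum>i\<in>A. a i * esym (Suc k) (A - {i}) a / esym (Suc k) A a)"
    using esym_euler[OF assms(1), of "Suc k" a] unfolding eratio_def
    by (simp add: sum_divide_distrib[symmetric])
  also have "\<dots> = (\<Sum>i\<in>A. a i * eratio k (A - {i}) a / (a i + eratio k (A - {i}) a))"
  proof (intro sum.cong refl)
    fix i assume i: "i \<in> A"
    have "0 < esym k (A - {i}) a" using assms i by (intro esym_pos) auto
    then show "a i * esym (Suc k) (A - {i}) a / esym (Suc k) A a
       = a i * eratio k (A - {i}) a / (a i + eratio k (A - {i}) a)"
      unfolding eratio_def esym_remove[OF assms(1) i, of k a] by (simp add: field_simps)
  qed
  finally show ?thesis .
qed

text \<open>
  Since \<open>x y / (x + y) = x - x\<^sup>2 / (x + y)\<close>, this follows from monotonicity in \<open>e\<close> and the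
  Cauchy-Schwarz inequality \<open>(a + b)\<^sup>2 / (p + q) \<le> a\<^sup>2 / p + b\<^sup>2 / q\<close> with \<open>p = a + c\<close>, \<open>q = b + d\<close>.
\<close>
lemma harmonic_superadditive:
  fixes a b c d e :: real
  assumes "0 < a" "0 < b" "0 \<le> c" "0 \<le> d" "c + d \<le> e"
  shows "a * c / (a + c) + b * d / (b + d) \<le> (a + b) * e / (a + b + e)"
proof -
  have *: "x * y / (x + y) = x - x\<^sup>2 / (x + y)" if "0 < x" "0 \<le> y" for x y :: real
    using that by (simp add: field_simps power2_eq_square)
  have "(a + b)\<^sup>2 / (a + b + e) \<le> (a + b)\<^sup>2 / ((a + c) + (b + d))"
    using assms by (intro divide_left_mono mult_pos_pos) auto
  also have "\<dots> \<le> a\<^sup>2 / (a + c) + b\<^sup>2 / (b + d)"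
  proof -
    have "a\<^sup>2 / (a + c) + b\<^sup>2 / (b + d) - (a + b)\<^sup>2 / ((a + c) + (b + d))
        = (a * (b + d) - b * (a + c))\<^sup>2 / ((a + c) * (b + d) * ((a + c) + (b + d)))"
    proof -
      have "a + c \<noteq> 0" "b + d \<noteq> 0" "(a + c) + (b + d) \<noteq> 0" using assms by auto
      moreover have "p \<noteq> 0 \<Longrightarrow> q \<noteq> 0 \<Longrightarrow> p + q \<noteq> 0 \<Longrightarrow>
         a\<^sup>2 / p + b\<^sup>2 / q - (a + b)\<^sup>2 / (p + q) = (a * q - b * p)\<^sup>2 / (p * q * (p + q))" for p q
        by (simp add: divide_simps) (simp add: algebra_simps power2_eq_square)
      ultimately show ?thesis by blast
    qed
    also have "\<dots> \<ge> 0" using assms by (intro divide_nonneg_nonneg) auto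
    finally show ?thesis by simp
  qed
  finally show ?thesis using assms by (simp add: *)
qed

text \<open>
  The theorem of Marcus and Lopes. As \<open>eratio k\<close> is homogeneous of degree one, superadditivity
  on the positive orthant is the same as concavity there.
\<close>
lemma eratio_superadditive:
  assumes "finite A" "\<And>i. i \<in> A \<Longrightarrow> 0 < a i" "\<And>i. i \<in> A \<Longrightarrow> 0 < b i"
  shows "eratio k A a + eratio k A b \<le> eratio k A (\<lambda>i. a i + b i)"
  using assms
proof (induction k arbitrary: A)
  case 0
  then show ?case by (simp add: eratio_def esym_1 sum.distrib)
next
  case (Suc k)
  show ?case
  proof (cases "Suc k \<le> card A")
    case False
    then show ?thesis using Suc.prems by (simp add: eratio_def esym_eq_0)
  next
    case True
    let ?c = "\<lambda>i. a i + b i" and ?r = "\<lambda>a i. eratio k (A - {i}) a"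
    have "real (Suc (Suc k)) * (eratio (Suc k) A a + eratio (Suc k) A b)
        = (\<Sum>i\<in>A. a i * ?r a i / (a i + ?r a i) + b i * ?r b i / (b i + ?r b i))"
      using Suc.prems True by (simp only: distrib_left eratio_rec sum.distrib)
    also have "\<dots> \<le> (\<Sum>i\<in>A. ?c i * ?r ?c i / (?c i + ?r ?c i))"
      using Suc by (intro sum_mono harmonic_superadditive eratio_nonneg Suc.IH) auto
    also have "\<dots> = real (Suc (Suc k)) * eratio (Suc k) A ?c"
      using Suc.prems True by (subst eratio_rec) (auto intro: add_pos_pos)
    finally show ?thesis by simp
  qed
qed

lemma eratio_midpoint:
  assumes "finite A" "\<And>i. i \<in> A \<Longrightarrow> 0 < a i" "\<And>i. i \<in> A \<Longrightarrow> 0 < b i"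
    and "\<And>i. i \<in> A \<Longrightarrow> 2 * c i = a i + b i"
  shows "eratio k A a * eratio k A b \<le> (eratio k A c)\<^sup>2"
proof -
  have "eratio k A (\<lambda>i. a i + b i) = eratio k A (\<lambda>i. 2 * c i)"
    unfolding eratio_def
    using esym_cong[of A "\<lambda>i. a i + b i" "\<lambda>i. 2 * c i"] assms(4) by (metis (no_types, lifting))
  also have "\<dots> = 2 * eratio k A c"
    unfolding eratio_def by (simp add: esym_scale)
  finally have le: "eratio k A a + eratio k A b \<le> 2 * eratio k A c"
    using eratio_superadditive[of A a b k] assms by simp
  have nn: "0 \<le> eratio k A a" "0 \<le> eratio k A b" using assms eratio_nonneg by blast+
  have "4 * (eratio k A a * eratio k A b) \<le> (eratio k A a + eratio k A b)\<^sup>2"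
    using sum_squares_bound[of "eratio k A a" "eratio k A b"] by (simp add: power2_sum)
  also have "\<dots> \<le> (2 * eratio k A c)\<^sup>2" using le nn by (intro power_mono) auto
  finally show ?thesis by (simp add: power_mult_distrib)
qed

text \<open>
  \<open>esym k\<close> is \<open>esym m\<close> times the quotients \<open>eratio j\<close> with \<open>m \<le> j < k\<close>, and each of these
  is midpoint log-concave. So \<open>esym k\<close> is at least as log-concave as \<open>esym m\<close>. With \<open>m = 2\<close>
  this reduces strict log-concavity in every degree to a statement about a quadratic form.
\<close>
lemma esym_log_concavity_dominates:
  fixes a b c :: "'i \<Rightarrow> real"
  assumes "finite A" "\<And>i. i \<in> A \<Longrightarrow> 0 < a i" "\<And>i. i \<in> A \<Longrightarrow> 0 < b i"
    and c: "\<And>i. i \<in> A \<Longrightarrow> 2 * c i = a i + b i"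
    and "m \<le> k" "k \<le> card A"
  shows "esym k A a * esym k A b * (esym m A c)\<^sup>2 \<le> (esym k A c)\<^sup>2 * (esym m A a * esym m A b)"
  using assms(5,6)
proof (induction rule: dec_induct)
  case base
  then show ?case by (simp add: mult_ac)
next
  case (step j)
  have cpos: "0 < c i" if "i \<in> A" for i using c[OF that] assms(2,3)[OF that] by linarith
  have j: "j \<le> card A" using step by simp
  have pos: "0 < esym j A a" "0 < esym j A b" "0 < esym j A c"
    by (rule esym_pos[OF assms(1) _ j]; simp add: assms(2,3) cpos)+
  have S: "esym (Suc j) A a = esym j A a * eratio j A a"
    "esym (Suc j) A b = esym j A b * eratio j A b"
    "esym (Suc j) A c = esym j A c * eratio j A c"
    using pos by (simp_all add: eratio_def)
  have r: "0 \<le> eratio j A a * eratio j A b"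
    using assms(2,3) by (simp add: eratio_nonneg)
  have IH: "esym j A a * esym j A b * (esym m A c)\<^sup>2 \<le> (esym j A c)\<^sup>2 * (esym m A a * esym m A b)"
    using step by simp
  have nn: "0 \<le> esym m A a * esym m A b"
    using assms(2,3) by (intro mult_nonneg_nonneg esym_nonneg) (auto intro: less_imp_le)
  have mid: "eratio j A a * eratio j A b \<le> (eratio j A c)\<^sup>2"
    using assms(1-4) by (rule eratio_midpoint)
  have "esym (Suc j) A a * esym (Suc j) A b * (esym m A c)\<^sup>2
      = (esym j A a * esym j A b * (esym m A c)\<^sup>2) * (eratio j A a * eratio j A b)"
    unfolding S by (simp only: mult_ac)
  also have "\<dots> \<le> ((esym j A c)\<^sup>2 * (esym m A a * esym m A b)) * (eratio j A c)\<^sup>2"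
    by (rule mult_mono[OF IH mid _ r]) (use nn in simp)
  also have "\<dots> = (esym (Suc j) A c)\<^sup>2 * (esym m A a * esym m A b)"
    unfolding S power_mult_distrib by (simp only: mult_ac)
  finally show ?case .
qed

section \<open>Principal minors and the characteristic polynomial\<close>

text \<open>
  The entries are a function of two indices, since the index set \<open>I\<close> varies within the statements
  below and is not a type over which a matrix could be formed.
\<close>
definition principal_minor :: "'i set \<Rightarrow> ('i \<Rightarrow> 'i \<Rightarrow> 'a::comm_ring_1) \<Rightarrow> 'a" where
  "principal_minor I M = (\<Sum>p | p permutes I. of_int (sign p) * (\<Prod>i\<in>I. M i (p i)))"

lemma principal_minor_empty [simp]: "principal_minor {} M = 1"
  by (simp add: principal_minor_def)

lemma principal_minor_singleton [simp]: "principal_minor {a} M = M a a"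
  by (simp add: principal_minor_def)

lemma principal_minor_doubleton: "a \<noteq> b \<Longrightarrow> principal_minor {a, b} M = M a a * M b b - M a b * M b a"
proof -
  assume ab: "a \<noteq> b"
  have "{p. p permutes {a, b}} = {id, Transposition.transpose a b}"
    by (auto simp: permutes_doubleton_iff)
  moreover have "id \<noteq> Transposition.transpose a b" using ab by (metis id_apply transpose_apply_first)
  ultimately show ?thesis using ab by (simp add: principal_minor_def sign_swap_id)
qed

lemma principal_minor_scale: "principal_minor I (\<lambda>i j. c * M i j) = c ^ card I * principal_minor I M"
  unfolding principal_minor_def sum_distrib_left by (simp add: prod.distrib mult_ac)

lemma principal_minor_0: "finite I \<Longrightarrow> principal_minor I (\<lambda>i j. 0) = (if I = {} then 1 else 0)"
  by (auto simp: principal_minor_def power_0_left)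

lemma principal_minor_const_poly: "principal_minor I (\<lambda>i j. [:M i j:]) = [:principal_minor I M:]"
  unfolding principal_minor_def sum_to_poly[symmetric] of_int_poly
  by (simp only: prod_to_poly mult_to_poly)

lemma principal_minor_of_real:
  "principal_minor I (\<lambda>i j. of_real (M i j) :: 'a::{comm_ring_1,real_algebra_1}) = of_real (principal_minor I M)"
  by (simp add: principal_minor_def)

text \<open>
  Expand the product over \<open>I\<close> by choosing the diagonal summand outside a set \<open>J\<close>. A permutation
  contributes only if it fixes every index outside \<open>J\<close>, that is, if it permutes \<open>J\<close>.
  The expansion serves over polynomials, for the characteristic polynomial, and
  over the reals, for the restriction of \<open>S k\<close> to a line through a diagonal matrix.
\<close>
lemma principal_minor_add_diag:
  assumes "finite I"
  shows "principal_minor I (\<lambda>i j. M i j + (if i = j then y i else 0))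
       = (\<Sum>J\<in>Pow I. principal_minor J M * (\<Prod>i\<in>I-J. y i))"
proof -
  have "principal_minor I (\<lambda>i j. M i j + (if i = j then y i else 0))
     = (\<Sum>p | p permutes I. \<Sum>J\<in>Pow I. of_int (sign p) *
          ((\<Prod>i\<in>J. M i (p i)) * (\<Prod>i\<in>I-J. if i = p i then y i else 0)))"
    unfolding principal_minor_def by (simp only: prod_add[OF assms] sum_distrib_left)
  also have "\<dots> = (\<Sum>J\<in>Pow I. \<Sum>p | p permutes I. of_int (sign p) *
          ((\<Prod>i\<in>J. M i (p i)) * (\<Prod>i\<in>I-J. if i = p i then y i else 0)))"
    by (rule sum.swap)
  also have "\<dots> = (\<Sum>J\<in>Pow I. principal_minor J M * (\<Prod>i\<in>I-J. y i))"
  proof (rule sum.cong[OF refl])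
    fix J assume J: "J \<in> Pow I"
    have "(\<Sum>p | p permutes I. of_int (sign p) *
          ((\<Prod>i\<in>J. M i (p i)) * (\<Prod>i\<in>I-J. if i = p i then y i else 0)))
       = (\<Sum>p | p permutes J. of_int (sign p) *
          ((\<Prod>i\<in>J. M i (p i)) * (\<Prod>i\<in>I-J. if i = p i then y i else 0)))"
    proof (rule sum.mono_neutral_right)
      show "finite {p. p permutes I}" using assms by (rule finite_permutations)
      show "{p. p permutes J} \<subseteq> {p. p permutes I}" using J permutes_subset by auto
      show "\<forall>p\<in>{p. p permutes I} - {p. p permutes J}. of_int (sign p) *
          ((\<Prod>i\<in>J. M i (p i)) * (\<Prod>i\<in>I-J. if i = p i then y i else 0)) = 0"
      proof
        fix p assume p: "p \<in> {p. p permutes I} - {p. p permutes J}"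
        then obtain i where "i \<in> I - J" "p i \<noteq> i" using permutes_superset[of p I J] by blast
        then have "(\<Prod>i\<in>I-J. if i = p i then y i else 0) = 0"
          using assms by (intro prod_zero) (auto intro!: bexI[of _ i])
        then show "of_int (sign p) *
          ((\<Prod>i\<in>J. M i (p i)) * (\<Prod>i\<in>I-J. if i = p i then y i else 0)) = 0" by simp
      qed
    qed
    also have "\<dots> = (\<Sum>p | p permutes J. of_int (sign p) *
          (\<Prod>i\<in>J. M i (p i)) * (\<Prod>i\<in>I-J. y i))"
    proof (rule sum.cong[OF refl])
      fix p assume "p \<in> {p. p permutes J}"
      then have "(\<Prod>i\<in>I-J. if i = p i then y i else 0) = (\<Prod>i\<in>I-J. y i)"
        by (intro prod.cong) (auto simp: permutes_not_in)
      then show "of_int (sign p) *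
          ((\<Prod>i\<in>J. M i (p i)) * (\<Prod>i\<in>I-J. if i = p i then y i else 0))
        = of_int (sign p) * (\<Prod>i\<in>J. M i (p i)) * (\<Prod>i\<in>I-J. y i)" by (simp only: mult.assoc)
    qed
    finally show "(\<Sum>p | p permutes I. of_int (sign p) *
          ((\<Prod>i\<in>J. M i (p i)) * (\<Prod>i\<in>I-J. if i = p i then y i else 0)))
       = principal_minor J M * (\<Prod>i\<in>I-J. y i)" by (simp only: principal_minor_def sum_distrib_right)
  qed
  finally show ?thesis .
qed

lemma principal_minor_diag: "finite I \<Longrightarrow> principal_minor I (\<lambda>i j. if i = j then y i else 0) = (\<Prod>i\<in>I. y i)"
proof -
  assume fin: "finite I"
  have "principal_minor I (\<lambda>i j. if i = j then y i else 0) = (\<Sum>J\<in>Pow I. principal_minor J (\<lambda>i j. 0) * (\<Prod>i\<in>I-J. y i))"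
    using principal_minor_add_diag[OF fin, of "\<lambda>i j. 0" y] by simp
  also have "\<dots> = (\<Sum>J\<in>Pow I. if J = {} then (\<Prod>i\<in>I. y i) else 0)"
  proof (rule sum.cong[OF refl])
    fix J assume "J \<in> Pow I"
    then have "finite J" using fin finite_subset by auto
    then show "principal_minor J (\<lambda>i j. 0) * (\<Prod>i\<in>I-J. y i) = (if J = {} then (\<Prod>i\<in>I. y i) else 0)"
      by (simp add: principal_minor_0)
  qed
  finally show ?thesis using fin by simp
qed

lemma charpoly_expansion:
  "charpoly (R :: real^'n^'n)
     = (\<Sum>J\<in>UNIV. monom ((-1) ^ card J * of_real (principal_minor J (\<lambda>i j. R $ i $ j))) (CARD('n) - card J))"
proof -
  let ?M = "\<lambda>i j. complex_of_real (R $ i $ j)"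
  have "charpoly R = principal_minor UNIV (\<lambda>i j. [:- ?M i j:] + (if i = j then [:0, 1:] else 0))"
    unfolding charpoly_def det_def principal_minor_def by (intro sum.cong arg_cong2[of _ _ _ _ "(*)"] prod.cong) auto
  also have "\<dots> = (\<Sum>J\<in>UNIV. [:principal_minor J (\<lambda>i j. -1 * ?M i j):] * (\<Prod>i\<in>UNIV-J. [:0, 1:]))"
    by (subst principal_minor_add_diag) (simp_all add: principal_minor_const_poly)
  also have "\<dots> = (\<Sum>J\<in>UNIV. monom ((-1) ^ card J * of_real (principal_minor J (\<lambda>i j. R $ i $ j))) (CARD('n) - card J))"
    unfolding principal_minor_scale principal_minor_of_real
    by (intro sum.cong refl) (simp add: monom_altdef card_Diff_subset)
  finally show ?thesis .
qed

lemma linear_factors_expansion: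
  fixes v :: "'a::comm_ring_1^'n"
  shows "(\<Prod>i\<in>UNIV. [:- (v $ i), 1:])
     = (\<Sum>J\<in>UNIV. monom ((-1) ^ card J * (\<Prod>i\<in>J. v $ i)) (CARD('n) - card J))"
proof -
  have "(\<Prod>i\<in>UNIV. [:- (v $ i), 1:]) = (\<Prod>i\<in>UNIV. [:-1 * v $ i:] + [:0, 1:])"
    by simp
  also have "\<dots> = (\<Sum>J\<in>UNIV. (\<Prod>i\<in>J. [:-1 * v $ i:]) * (\<Prod>i\<in>UNIV-J. [:0, 1:]))"
    by (subst prod_add) simp_all
  also have "\<dots> = (\<Sum>J\<in>UNIV. monom ((-1) ^ card J * (\<Prod>i\<in>J. v $ i)) (CARD('n) - card J))"
    unfolding prod_to_poly prod.distrib prod_constant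
    by (intro sum.cong refl) (simp add: monom_altdef card_Diff_subset)
  finally show ?thesis .
qed

lemma coeff_subset_expansion:
  fixes c :: "'n::finite set \<Rightarrow> 'a::comm_ring_1"
  assumes "k \<le> CARD('n)"
  shows "coeff (\<Sum>J\<in>UNIV. monom ((-1) ^ card J * c J) (CARD('n) - card J)) (CARD('n) - k)
       = (-1) ^ k * (\<Sum>J | card J = k. c J)"
proof -
  have eq: "(CARD('n) - card J = CARD('n) - k) \<longleftrightarrow> card J = k" for J :: "'n set"
    using assms card_mono[of UNIV J] by auto
  have "coeff (\<Sum>J\<in>UNIV. monom ((-1) ^ card J * c J) (CARD('n) - card J)) (CARD('n) - k)
     = (\<Sum>J\<in>UNIV. if card J = k then (-1) ^ k * c J else 0)"
    unfolding coeff_sum coeff_monom eq by (intro sum.cong) auto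
  also have "\<dots> = (\<Sum>J\<in>UNIV \<inter> {J. card J = k}. (-1) ^ k * c J)"
    by (simp add: sum.If_cases)
  finally show ?thesis by (simp add: sum_distrib_left)
qed

lemma prod_list_vec:
  assumes "length xs = CARD('n::finite)"
  shows "\<exists>v :: 'a^'n. prod_list (map f xs) = (\<Prod>i\<in>UNIV. f (v $ i) :: 'b::comm_monoid_mult)"
proof -
  obtain h :: "'n \<Rightarrow> nat" where h: "bij_betw h UNIV {..<CARD('n)}"
    using finite_same_card_bij[of "UNIV :: 'n set" "{..<CARD('n)}"] by auto
  have "prod_list (map f xs) = (\<Prod>i<CARD('n). f (xs ! i))"
    using assms by (simp add: prod.list_conv_set_nth atLeast0LessThan)
  also have "\<dots> = (\<Prod>i\<in>UNIV. f (xs ! h i))"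
    using prod.reindex_bij_betw[OF h, of "\<lambda>i. f (xs ! i)"] by simp
  finally show ?thesis by (intro exI[of _ "\<chi> i. xs ! h i"]) simp
qed

text \<open>
  The complex numbers are algebraically closed, so the choice in the definition of \<open>eigvals\<close>
  has a witness: the characteristic polynomial is monic of degree \<open>CARD('n)\<close> and splits.
\<close>
lemma charpoly_eigvals: "charpoly R = (\<Prod>i\<in>UNIV. [:- (eigvals R $ i), 1:])"
proof -
  let ?n = "CARD('a)"
  have c: "coeff (charpoly R) ?n = 1"
  proof -
    have "{J. card J = 0} = {{} :: 'a set}" by auto
    then show ?thesis
      using coeff_subset_expansion[of 0 "\<lambda>J. complex_of_real (principal_minor J (\<lambda>i j. R $ i $ j))"]
      unfolding charpoly_expansion by simp
  qed
  have "degree (charpoly R) \<le> ?n"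
    unfolding charpoly_expansion by (intro degree_sum_le) (auto intro: order_trans[OF degree_monom_le])
  then have deg: "degree (charpoly R) = ?n" using c le_degree[of "charpoly R" ?n] by simp
  then obtain A where A: "size A = ?n" "charpoly R = (\<Prod>x\<in>#A. [:-x, 1:])"
    using alg_closed_imp_factorization[of "charpoly R"] c by force
  obtain xs where xs: "mset xs = A" using ex_mset by blast
  have "charpoly R = prod_list (map (\<lambda>x. [:-x, 1:]) xs)"
    using A xs by (metis mset_map prod_mset_prod_list)
  then have "\<exists>v :: complex^'a. charpoly R = (\<Prod>i\<in>UNIV. [:- (v $ i), 1:])"
    using prod_list_vec[of xs "\<lambda>x. [:-x, 1:]"] A xs by (metis size_mset)
  then show ?thesis unfolding eigvals_def by (rule someI_ex)
qed

text \<open>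
  Both sides are, up to the sign \<open>(-1) ^ k\<close>, the coefficient of degree \<open>CARD('n) - k\<close> of the
  characteristic polynomial. This makes \<open>S k\<close> a polynomial in the entries of the matrix.
\<close>
lemma S_eq_sum_minors:
  fixes R :: "real^'n^'n"
  assumes "k \<le> CARD('n)"
  shows "S k R = (\<Sum>I | card I = k. principal_minor I (\<lambda>i j. R $ i $ j))"
proof -
  have "(-1) ^ k * sigma k (eigvals R)
     = (-1) ^ k * (\<Sum>I | card I = k. complex_of_real (principal_minor I (\<lambda>i j. R $ i $ j)))"
    using charpoly_eigvals[of R, unfolded linear_factors_expansion charpoly_expansion]
      coeff_subset_expansion[OF assms, of "\<lambda>J. \<Prod>i\<in>J. eigvals R $ i"]
      coeff_subset_expansion[OF assms, of "\<lambda>J. complex_of_real (principal_minor J (\<lambda>i j. R $ i $ j))"]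
    unfolding sigma_def by simp
  then have "sigma k (eigvals R) = of_real (\<Sum>I | card I = k. principal_minor I (\<lambda>i j. R $ i $ j))"
    by simp
  then show ?thesis by (simp add: S_def)
qed

text \<open>
  The relation \<open>B (X - R) = (X - R') B\<close> over polynomials has only one product on each side, so it can be
  checked entrywise; taking determinants and cancelling \<open>det B\<close> gives the claim.
\<close>
lemma charpoly_similar:
  fixes R R' B B' :: "real^'n^'n"
  assumes "B ** R = R' ** B" "B' ** B = mat 1"
  shows "charpoly R = charpoly R'"
proof -
  let ?p = "\<lambda>A :: real^'n^'n. (\<chi> i j. [:complex_of_real (A $ i $ j):])"
  let ?X = "\<lambda>A :: real^'n^'n. (\<chi> i j. (if i = j then [:0, 1:] else 0) - [:complex_of_real (A $ i $ j):])"
  have hom: "(\<Sum>k\<in>UNIV. [:complex_of_real (A $ i $ k):] * [:complex_of_real (A' $ k $ j):])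
     = [:complex_of_real ((A ** A') $ i $ j):]" for A A' :: "real^'n^'n" and i j
    by (simp only: matrix_matrix_mult_def sum_to_poly mult_to_poly) simp
  have "?p B ** ?X R = ?X R' ** ?p B"
  proof -
    have "(\<Sum>k\<in>UNIV. [:complex_of_real (B $ i $ k):] * (if k = j then [:0, 1:] else 0))
        = (\<Sum>k\<in>UNIV. (if i = k then [:0, 1:] else 0) * [:complex_of_real (B $ k $ j):])" for i j
    proof -
      have "(\<Sum>k\<in>UNIV. [:complex_of_real (B $ i $ k):] * (if k = j then [:0, 1:] else 0))
          = (\<Sum>k\<in>UNIV. if k = j then [:complex_of_real (B $ i $ k):] * [:0, 1:] else 0)"
        by (intro sum.cong) auto
      moreover have "(\<Sum>k\<in>UNIV. (if i = k then [:0, 1:] else 0) * [:complex_of_real (B $ k $ j):])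
          = (\<Sum>k\<in>UNIV. if i = k then [:0, 1:] * [:complex_of_real (B $ k $ j):] else 0)"
        by (intro sum.cong) auto
      ultimately show ?thesis by simp
    qed
    then have ent: "(?p B ** ?X R) $ i $ j = (?X R' ** ?p B) $ i $ j" for i j
      unfolding matrix_matrix_mult_def[of "?p B"] matrix_matrix_mult_def[of _ "?p B"]
      by (simp only: vec_lambda_beta right_diff_distrib left_diff_distrib sum_subtractf hom assms(1))
    show ?thesis by (intro iffD2[OF vec_eq_iff] allI ent)
  qed
  from arg_cong[OF this, of det]
  have "det (?p B) * det (?X R) = det (?X R') * det (?p B)" by (simp only: det_mul)
  moreover have "det (?p B) \<noteq> 0"
  proof -
    have "?p B' ** ?p B = ?p (mat 1)"
      unfolding assms(2)[symmetric] matrix_matrix_mult_def[of "?p B'"]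
      by (simp only: vec_eq_iff vec_lambda_beta hom simp_thms)
    also have "\<dots> = mat 1" by (auto simp: vec_eq_iff mat_def)
    finally have "?p B' ** ?p B = mat 1" .
    from arg_cong[OF this, of det] have "det (?p B') * det (?p B) = 1" by (simp only: det_mul det_I)
    then show ?thesis by (metis mult_zero_right zero_neq_one)
  qed
  ultimately show ?thesis
    unfolding charpoly_def by (simp only: mult.commute[of _ "det (?p B)"] mult_cancel_left simp_thms)
qed

section \<open>Strict log-concavity along lines through a diagonal matrix\<close>

text \<open>
  The polynomial that gives \<open>S k (diag l + t M)\<close> as a function of \<open>t\<close>. Keeping it formal lets
  first and second derivatives at \<open>0\<close> be read off as coefficients.
\<close>
definition line_poly :: "nat \<Rightarrow> ('n::finite \<Rightarrow> real) \<Rightarrow> ('n \<Rightarrow> 'n \<Rightarrow> real) \<Rightarrow> real poly" where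
  "line_poly k l M =
     (\<Sum>I | card I = k. \<Sum>J\<in>Pow I. monom (principal_minor J M * (\<Prod>i\<in>I-J. l i)) (card J))"

lemma poly_line_poly:
  "poly (line_poly k l M) t
     = (\<Sum>I | card I = k. principal_minor I (\<lambda>i j. t * M i j + (if i = j then l i else 0)))"
  unfolding line_poly_def poly_sum principal_minor_add_diag[OF finite] principal_minor_scale
  by (simp add: poly_monom mult_ac)

lemma coeff_line_poly:
  "coeff (line_poly k l M) m
     = (\<Sum>I | card I = k. \<Sum>J | J \<subseteq> I \<and> card J = m. principal_minor J M * (\<Prod>i\<in>I-J. l i))"
  unfolding line_poly_def coeff_sum coeff_monom
  by (rule sum.cong[OF refl]) (simp flip: sum.inter_filter)

lemma poly_line_poly_diag:
  "poly (line_poly k l (\<lambda>i j. if i = j then p i else 0)) t = esym k UNIV (\<lambda>i. l i + t * p i)"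
proof -
  have "(\<lambda>i j. t * (if i = j then p i else 0) + (if i = j then l i else 0))
      = (\<lambda>i j. if i = j then l i + t * p i else 0)" by (simp add: fun_eq_iff)
  then show ?thesis unfolding poly_line_poly esym_def by (simp add: principal_minor_diag)
qed

lemma esym_2: "finite A \<Longrightarrow> 2 * esym 2 A a = (\<Sum>i\<in>A. a i)\<^sup>2 - (\<Sum>i\<in>A. (a i)\<^sup>2 :: real)"
proof (induction rule: finite_induct)
  case empty
  then show ?case by (simp add: esym_eq_0)
next
  case (insert x A)
  then show ?case
    using esym_insert[of A x "Suc 0" a]
    by (simp add: esym_1 numeral_2_eq_2[symmetric] power2_sum algebra_simps)
qed

lemma coeff_0_line_poly: "coeff (line_poly k l M) 0 = esym k UNIV l"
proof -
  have "{J. J \<subseteq> I \<and> card J = 0} = {{}}" for I :: "'a set" by auto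
  then show ?thesis unfolding coeff_line_poly esym_def by simp
qed

text \<open>
  Minors of size one see only the diagonal, so off-diagonal entries of the direction enter first in the
  coefficient of degree two.
\<close>
lemma coeff_1_line_poly_cong:
  assumes "\<And>i. M i i = N i i"
  shows "coeff (line_poly k l M) 1 = coeff (line_poly k l N) 1"
  unfolding coeff_line_poly
proof (intro sum.cong refl)
  fix I J :: "'a set" assume "J \<in> {J. J \<subseteq> I \<and> card J = 1}"
  then obtain a where "J = {a}" by (auto simp: card_1_singleton_iff)
  then show "principal_minor J M * (\<Prod>i\<in>I-J. l i) = principal_minor J N * (\<Prod>i\<in>I-J. l i)" using assms by simp
qed

lemma esym_2_line_poly:
  "line_poly 2 l (\<lambda>i j. if i = j then p i else 0) =
     [:esym 2 UNIV l, (\<Sum>i\<in>UNIV. l i) * (\<Sum>i\<in>UNIV. p i) - (\<Sum>i\<in>UNIV. l i * p i), esym 2 UNIV p:]"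
proof -
  have "poly (line_poly 2 l (\<lambda>i j. if i = j then p i else 0)) t =
     poly [:esym 2 UNIV l, (\<Sum>i\<in>UNIV. l i) * (\<Sum>i\<in>UNIV. p i) - (\<Sum>i\<in>UNIV. l i * p i), esym 2 UNIV p:] t" for t
  proof -
    have "2 * esym 2 UNIV (\<lambda>i. l i + t * p i) = 2 * esym 2 UNIV l
      + 2 * t * ((\<Sum>i\<in>UNIV. l i) * (\<Sum>i\<in>UNIV. p i) - (\<Sum>i\<in>UNIV. l i * p i)) + t\<^sup>2 * (2 * esym 2 UNIV p)"
    proof -
      have "(\<Sum>i\<in>UNIV. l i + t * p i) = (\<Sum>i\<in>UNIV. l i) + t * (\<Sum>i\<in>UNIV. p i)"
        by (simp add: sum.distrib sum_distrib_left)
      moreover have "(\<Sum>i\<in>UNIV. (l i + t * p i)\<^sup>2)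
        = (\<Sum>i\<in>UNIV. (l i)\<^sup>2) + 2 * t * (\<Sum>i\<in>UNIV. l i * p i) + t\<^sup>2 * (\<Sum>i\<in>UNIV. (p i)\<^sup>2)"
        by (simp add: sum.distrib sum_distrib_left power2_sum power_mult_distrib mult_ac)
      ultimately show ?thesis
        unfolding esym_2[OF finite] by (simp only:) (simp add: power2_eq_square algebra_simps)
    qed
    then show ?thesis unfolding poly_line_poly_diag by (simp add: algebra_simps power2_eq_square)
  qed
  then show ?thesis by (simp add: poly_eq_poly_eq_iff[symmetric] fun_eq_iff)
qed

text \<open>
  The quadratic form \<open>2 * esym 2\<close> has Lorentzian signature, and \<open>l\<close> is timelike. Split
  \<open>p = r + c l\<close> with \<open>r\<close> of coordinate sum zero; on such vectors the form is \<open>- |r|\<^sup>2\<close>.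
  In these terms twice the difference of the two sides is a sum of squares that
  vanishes only if \<open>r = 0\<close> and \<open>c = 0\<close>.
\<close>
lemma esym_2_newton_strict:
  fixes l p :: "'n::finite \<Rightarrow> real"
  assumes l: "\<And>i. 0 < l i" and n: "2 \<le> CARD('n)" and p: "p \<noteq> (\<lambda>i. 0)"
  shows "2 * esym 2 UNIV l * esym 2 UNIV p
       < ((\<Sum>i\<in>UNIV. l i) * (\<Sum>i\<in>UNIV. p i) - (\<Sum>i\<in>UNIV. l i * p i))\<^sup>2"
proof -
  define s where "s = (\<Sum>i\<in>UNIV. l i)"
  define c where "c = (\<Sum>i\<in>UNIV. p i) / s"
  define r where "r = (\<lambda>i. p i - c * l i)"
  define L where "L = 2 * esym 2 UNIV l"
  define b where "b = (\<Sum>i\<in>UNIV. l i * r i)"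
  define q where "q = (\<Sum>i\<in>UNIV. (r i)\<^sup>2)"
  have s: "0 < s" unfolding s_def using l by (intro sum_pos) auto
  have L: "0 < L" unfolding L_def using l n by (simp add: esym_pos)
  have pr: "p i = r i + c * l i" for i by (simp add: r_def)
  have sp: "(\<Sum>i\<in>UNIV. p i) = c * s" using s by (simp add: c_def)
  have Ls: "(\<Sum>i\<in>UNIV. (l i)\<^sup>2) = s\<^sup>2 - L" unfolding L_def s_def by (simp add: esym_2)
  have lp: "(\<Sum>i\<in>UNIV. l i * p i) = b + c * (s\<^sup>2 - L)"
    unfolding pr Ls[symmetric] b_def
    by (simp add: algebra_simps sum.distrib sum_distrib_left power2_eq_square)
  have pp: "(\<Sum>i\<in>UNIV. (p i)\<^sup>2) = q + 2 * c * b + c\<^sup>2 * (s\<^sup>2 - L)"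
    unfolding pr Ls[symmetric] b_def q_def
    by (simp add: algebra_simps sum.distrib sum_distrib_left power2_eq_square)
  have "2 * esym 2 UNIV p = c\<^sup>2 * L - q - 2 * c * b"
    unfolding esym_2[OF finite] sp pp by (simp add: algebra_simps power_mult_distrib)
  then have "2 * (2 * esym 2 UNIV l * esym 2 UNIV p) = L * (c\<^sup>2 * L - q - 2 * c * b)"
    unfolding L_def by simp
  also have "\<dots> = 2 * (c * L - b)\<^sup>2 - ((c * L - b)\<^sup>2 + L * q + b\<^sup>2)"
    by (simp add: power2_eq_square algebra_simps)
  finally have eq: "2 * (2 * esym 2 UNIV l * esym 2 UNIV p)
     = 2 * (c * L - b)\<^sup>2 - ((c * L - b)\<^sup>2 + L * q + b\<^sup>2)" .
  have "0 < (c * L - b)\<^sup>2 + L * q + b\<^sup>2"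
  proof (cases "r = (\<lambda>i. 0)")
    case True
    then have "b = 0" "q = 0" "c \<noteq> 0" using p by (auto simp: b_def q_def r_def fun_eq_iff)
    then show ?thesis using L by simp
  next
    case False
    then obtain i where "r i \<noteq> 0" by auto
    then have "0 < q" unfolding q_def by (intro sum_pos2[of _ i]) auto
    then show ?thesis using L by (smt (verit) mult_pos_pos zero_le_power2)
  qed
  moreover have d: "s * (c * s) - (b + c * (s\<^sup>2 - L)) = c * L - b"
    by (simp add: power2_eq_square algebra_simps)
  ultimately show ?thesis using eq unfolding lp sp s_def[symmetric] d by linarith
qed

text \<open>
  This turns an inequality between functions of \<open>t\<close> that are equal to first order at \<open>0\<close> into an
  inequality between their second-order coefficients.
\<close>
lemma coeff_2_nonneg_if_nonneg_at_right:
  fixes H :: "real poly"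
  assumes "coeff H 0 = 0" "coeff H 1 = 0" and nn: "\<And>t. 0 < t \<Longrightarrow> t < e \<Longrightarrow> 0 \<le> poly H t" and "0 < e"
  shows "0 \<le> coeff H 2"
proof -
  obtain Q where Q: "H = pCons 0 (pCons 0 Q)"
    using assms(1,2) by (metis One_nat_def coeff_pCons_0 coeff_pCons_Suc pCons_cases)
  have "0 \<le> poly Q t" if "0 < t" "t < e" for t
  proof -
    have "0 \<le> t * (t * poly Q t)" using nn[OF that] by (simp add: Q)
    then show ?thesis using that by (simp add: zero_le_mult_iff)
  qed
  then have "eventually (\<lambda>t. 0 \<le> poly Q t) (at_right 0)"
    using assms(4) by (auto simp: eventually_at_right_field)
  moreover have "(poly Q \<longlongrightarrow> poly Q 0) (at_right 0)"
    using isCont_def poly_isCont tendsto_within_subset by blast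
  ultimately have "0 \<le> poly Q 0" by (intro tendsto_lowerbound) auto
  then show ?thesis by (simp add: Q numeral_2_eq_2 poly_0_coeff_0)
qed

text \<open>
  For \<open>f\<close> with positive constant term, the coefficient of \<open>t\<^sup>2\<close> in \<open>f(t) f(-t)\<close> is
  \<open>f(0)\<^sup>2\<close> times the second derivative of \<open>log f\<close> at \<open>0\<close>.
\<close>
lemma coeff_mult_reflect:
  fixes f :: "real poly"
  defines "g \<equiv> f * pcompose f [:0, -1:]"
  shows "coeff g 0 = (coeff f 0)\<^sup>2" "coeff g 1 = 0"
    "coeff g 2 = 2 * coeff f 0 * coeff f 2 - (coeff f 1)\<^sup>2"
  unfolding g_def coeff_mult coeff_pcompose_linear
  by (simp_all add: power2_eq_square numeral_2_eq_2 poly_0_coeff_0)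

text \<open>
  Compare \<open>esym k\<close> with \<open>esym 2\<close> at \<open>l + t p\<close>, \<open>l - t p\<close> and their midpoint \<open>l\<close>, and
  extract the coefficients of \<open>t\<^sup>2\<close>; the quadratic case then supplies strictness.
\<close>
lemma esym_newton_strict:
  fixes l p :: "'n::finite \<Rightarrow> real"
  assumes l: "\<And>i. 0 < l i" and k: "2 \<le> k" "k \<le> CARD('n)" and p: "p \<noteq> (\<lambda>i. 0)"
  defines "f \<equiv> line_poly k l (\<lambda>i j. if i = j then p i else 0)"
  shows "2 * coeff f 0 * coeff f 2 < (coeff f 1)\<^sup>2"
proof -
  define g where "g = line_poly 2 l (\<lambda>i j. if i = j then p i else 0)"
  define E where "E = esym k UNIV l"
  define G where "G = esym 2 UNIV l"
  have E: "coeff f 0 = E" and G: "coeff g 0 = G"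
    by (simp_all add: f_def g_def E_def G_def coeff_0_line_poly)
  have pos: "0 < E" "0 < G" unfolding E_def G_def using l k by (auto intro!: esym_pos)
  define H where "H = smult (E\<^sup>2) (g * pcompose g [:0, -1:]) - smult (G\<^sup>2) (f * pcompose f [:0, -1:])"
  have "0 \<le> coeff H 2"
  proof (rule coeff_2_nonneg_if_nonneg_at_right)
    show "coeff H 0 = 0" "coeff H 1 = 0"
      by (simp_all only: H_def coeff_diff coeff_smult coeff_mult_reflect E G) simp_all
    \<comment> \<open>Below this bound both \<open>l + t p\<close> and \<open>l - t p\<close> are positive; the summand 1 avoids division by zero.\<close>
    define e where "e = Min (range (\<lambda>i. l i / (\<bar>p i\<bar> + 1)))"
    show "0 < e" unfolding e_def using l by (subst Min_gr_iff) (auto intro!: divide_pos_pos)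
    show "0 \<le> poly H t" if t: "0 < t" "t < e" for t
    proof -
      have "t * \<bar>p i\<bar> < l i" for i
      proof -
        have "t < l i / (\<bar>p i\<bar> + 1)" using t(2) unfolding e_def by simp
        then have "t * (\<bar>p i\<bar> + 1) < l i" by (simp add: pos_less_divide_eq)
        then show ?thesis using t(1) by (simp add: distrib_left)
      qed
      then have abs: "\<bar>t * p i\<bar> < l i" for i using t(1) by (simp add: abs_mult)
      have *: "0 < l i + t * p i" "0 < l i + (-t) * p i" for i
        unfolding mult_minus_left using abs[of i] by linarith+
      have "esym k UNIV (\<lambda>i. l i + t * p i) * esym k UNIV (\<lambda>i. l i + (-t) * p i) * G\<^sup>2
          \<le> E\<^sup>2 * (esym 2 UNIV (\<lambda>i. l i + t * p i) * esym 2 UNIV (\<lambda>i. l i + (-t) * p i))"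
        unfolding E_def G_def using k * by (intro esym_log_concavity_dominates) auto
      then show ?thesis
        unfolding H_def f_def g_def
        by (simp add: poly_pcompose poly_line_poly_diag mult_ac)
    qed
  qed
  then have le: "G\<^sup>2 * (2 * coeff f 0 * coeff f 2 - (coeff f 1)\<^sup>2)
     \<le> E\<^sup>2 * (2 * coeff g 0 * coeff g 2 - (coeff g 1)\<^sup>2)"
    by (simp only: H_def coeff_diff coeff_smult coeff_mult_reflect)
  have "2 * coeff g 0 * coeff g 2 - (coeff g 1)\<^sup>2 < 0"
    using esym_2_newton_strict[of l p] l k p unfolding g_def esym_2_line_poly
    by (simp add: numeral_2_eq_2)
  then have "E\<^sup>2 * (2 * coeff g 0 * coeff g 2 - (coeff g 1)\<^sup>2) < 0"
    using pos by (simp add: mult_less_0_iff)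
  with le have "G\<^sup>2 * (2 * coeff f 0 * coeff f 2 - (coeff f 1)\<^sup>2) < 0" by linarith
  then show ?thesis by (simp add: mult_less_0_iff)
qed

text \<open>
  Replacing a symmetric \<open>M\<close> by its diagonal raises each two-by-two minor by the square of
  its off-diagonal entry and changes neither of the two lower coefficients. Hence a nonzero diagonal
  gives strictness through the vector case, and a direction with zero diagonal gives it through
  any nonzero off-diagonal entry.
\<close>
lemma line_poly_newton_strict:
  fixes l :: "'n::finite \<Rightarrow> real"
  assumes l: "\<And>i. 0 < l i" and k: "2 \<le> k" "k \<le> CARD('n)"
    and sym: "\<And>i j. M i j = M j i" and nz: "M a b \<noteq> 0"
  defines "f \<equiv> line_poly k l M"
  shows "2 * coeff f 0 * coeff f 2 < (coeff f 1)\<^sup>2"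
proof -
  define D where "D = (\<lambda>i j :: 'n. if i = j then M i i else 0)"
  define g where "g = line_poly k l D"
  have D: "D = (\<lambda>i j. if i = j then (\<lambda>i. M i i) i else 0)" by (simp add: D_def)
  have c0: "coeff f 0 = coeff g 0" by (simp add: f_def g_def coeff_0_line_poly)
  have c1: "coeff f 1 = coeff g 1" unfolding f_def g_def by (rule coeff_1_line_poly_cong) (simp add: D_def)
  have pos: "0 < coeff g 0" unfolding g_def coeff_0_line_poly using l k by (intro esym_pos) auto
  have lpos: "0 < (\<Prod>i\<in>I. l i)" for I using l by (simp add: prod_pos)
  have mle: "principal_minor J M \<le> principal_minor J D" if "card J = 2" for J
    using that unfolding card_2_iff by (auto simp: principal_minor_doubleton D_def sym)
  have term_le: "principal_minor J M * (\<Prod>i\<in>I-J. l i) \<le> principal_minor J D * (\<Prod>i\<in>I-J. l i)" if "card J = 2" for I J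
    using mle[OF that] lpos[of "I - J"] by simp
  have c2: "coeff f 2 \<le> coeff g 2"
    unfolding f_def g_def coeff_line_poly by (intro sum_mono term_le) auto
  show ?thesis
  proof (cases "(\<lambda>i. M i i) = (\<lambda>i. 0)")
    case False
    have "2 * coeff g 0 * coeff g 2 < (coeff g 1)\<^sup>2"
      unfolding g_def D by (rule esym_newton_strict) (use l k False in auto)
    moreover have "2 * coeff g 0 * coeff f 2 \<le> 2 * coeff g 0 * coeff g 2"
      using c2 pos by simp
    ultimately show ?thesis using c0 c1 by simp
  next
    case True
    then have ab: "a \<noteq> b" using nz by (metis (mono_tags, lifting))
    have "D = (\<lambda>i j. 0)" using True by (auto simp: D_def fun_eq_iff)
    then have g2: "coeff g 2 = 0"
      unfolding g_def coeff_line_poly by (intro sum.neutral ballI) (auto simp: principal_minor_0)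
    obtain I where I: "{a, b} \<subseteq> I" "card I = k"
    proof -
      \<comment> \<open>Some \<open>k\<close>-set contains both \<open>a\<close> and \<open>b\<close>, so the term \<open>M a b ^ 2\<close> does occur.\<close>
      have "k - 2 \<le> card (UNIV - {a, b})" using k ab by (simp add: card_Diff_subset)
      then obtain K where "K \<subseteq> UNIV - {a, b}" "card K = k - 2" by (meson obtain_subset_with_card_n)
      moreover from this have "card ({a, b} \<union> K) = card {a, b} + card K"
        by (intro card_Un_disjoint) (auto intro: finite_subset)
      ultimately show ?thesis using that[of "{a, b} \<union> K"] ab k by simp
    qed
    have "coeff f 2 < coeff g 2"
      unfolding f_def g_def coeff_line_poly
    proof (rule sum_strict_mono_ex1)
      show "\<forall>I\<in>{I. card I = k}. (\<Sum>J | J \<subseteq> I \<and> card J = 2. principal_minor J M * (\<Prod>i\<in>I-J. l i))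
          \<le> (\<Sum>J | J \<subseteq> I \<and> card J = 2. principal_minor J D * (\<Prod>i\<in>I-J. l i))"
        by (intro ballI sum_mono term_le) auto
      have "(\<Sum>J | J \<subseteq> I \<and> card J = 2. principal_minor J M * (\<Prod>i\<in>I-J. l i))
          < (\<Sum>J | J \<subseteq> I \<and> card J = 2. principal_minor J D * (\<Prod>i\<in>I-J. l i))"
      proof (rule sum_strict_mono_ex1)
        show "\<forall>J\<in>{J. J \<subseteq> I \<and> card J = 2}. principal_minor J M * (\<Prod>i\<in>I-J. l i) \<le> principal_minor J D * (\<Prod>i\<in>I-J. l i)"
          using term_le by auto
        have "principal_minor {a, b} M < principal_minor {a, b} D"
          using ab nz sym[of b a] by (simp add: principal_minor_doubleton D_def flip: power2_eq_square)
        then show "\<exists>J\<in>{J. J \<subseteq> I \<and> card J = 2}. principal_minor J M * (\<Prod>i\<in>I-J. l i) < principal_minor J D * (\<Prod>i\<in>I-J. l i)"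
          using I ab lpos by (intro bexI[of _ "{a, b}"]) auto
      qed simp
      then show "\<exists>I\<in>{I. card I = k}. (\<Sum>J | J \<subseteq> I \<and> card J = 2. principal_minor J M * (\<Prod>i\<in>I-J. l i))
          < (\<Sum>J | J \<subseteq> I \<and> card J = 2. principal_minor J D * (\<Prod>i\<in>I-J. l i))"
        using I by auto
    qed simp
    then have "2 * coeff g 0 * coeff f 2 < 0" using g2 pos by (simp add: mult_less_0_iff)
    then show ?thesis using c0 by (smt (verit) zero_le_power2)
  qed
qed

section \<open>Derivatives of polynomial functions of a matrix\<close>

definition dir_deriv :: "('a::real_normed_vector \<Rightarrow> real) \<Rightarrow> 'a \<Rightarrow> 'a \<Rightarrow> real" where
  "dir_deriv f M R = deriv (\<lambda>t. f (R + t *\<^sub>R M)) 0"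

lemma entry_deriv_eq_dir_deriv: "entry_deriv i j f R = dir_deriv f (axis i (axis j 1)) R"
  by (simp add: entry_deriv_def dir_deriv_def)

text \<open>
  Directional derivatives of a polynomial function exist, are again polynomial, and depend linearly on the
  direction. These three properties, proved together by induction, replace any
  general calculus of iterated partial derivatives.
\<close>
lemma real_polynomial_function_has_gradient:
  assumes "real_polynomial_function f"
  shows "\<exists>g. (\<forall>M. real_polynomial_function (g M)) \<and> (\<forall>R. linear (\<lambda>M. g M R)) \<and>
    (\<forall>R M t. ((\<lambda>t. f (R + t *\<^sub>R M)) has_real_derivative g M (R + t *\<^sub>R M)) (at t))"
  using assms
proof induction
  case (linear f)
  have "((\<lambda>t. f (R + t *\<^sub>R M)) has_real_derivative f M) (at t)" for R M t
    unfolding linear_add[OF bounded_linear.linear[OF linear]]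
      linear_scale[OF bounded_linear.linear[OF linear]]
    by (auto intro!: derivative_eq_intros)
  then show ?case
    using linear by (intro exI[of _ "\<lambda>M R. f M"]) (auto simp: bounded_linear.linear)
next
  case (const c)
  show ?case by (intro exI[of _ "\<lambda>M R. 0"]) (auto simp: linear_iff)
next
  case (add f g)
  then obtain f' g' where
    "\<And>M. real_polynomial_function (f' M)" "\<And>R. linear (\<lambda>M. f' M R)"
    "\<And>R M t. ((\<lambda>t. f (R + t *\<^sub>R M)) has_real_derivative f' M (R + t *\<^sub>R M)) (at t)"
    "\<And>M. real_polynomial_function (g' M)" "\<And>R. linear (\<lambda>M. g' M R)"
    "\<And>R M t. ((\<lambda>t. g (R + t *\<^sub>R M)) has_real_derivative g' M (R + t *\<^sub>R M)) (at t)"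
    by blast
  then show ?case
    by (intro exI[of _ "\<lambda>M R. f' M R + g' M R"])
       (auto intro!: derivative_eq_intros linear_compose_add)
next
  case (mult f g)
  then obtain f' g' where *:
    "\<And>M. real_polynomial_function (f' M)" "\<And>R. linear (\<lambda>M. f' M R)"
    "\<And>R M t. ((\<lambda>t. f (R + t *\<^sub>R M)) has_real_derivative f' M (R + t *\<^sub>R M)) (at t)"
    "\<And>M. real_polynomial_function (g' M)" "\<And>R. linear (\<lambda>M. g' M R)"
    "\<And>R M t. ((\<lambda>t. g (R + t *\<^sub>R M)) has_real_derivative g' M (R + t *\<^sub>R M)) (at t)"
    by blast
  have "linear (\<lambda>M. f' M R * g R + g' M R * f R)" for R
    using *(2)[of R] *(5)[of R] by (auto simp: linear_iff algebra_simps)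
  moreover have "real_polynomial_function (\<lambda>R. f' M R * g R + g' M R * f R)" for M
    using * mult.hyps by (intro real_polynomial_function.intros(3) real_polynomial_function.intros(4))
  moreover have "((\<lambda>t. f (R + t *\<^sub>R M) * g (R + t *\<^sub>R M)) has_real_derivative
      f' M (R + t *\<^sub>R M) * g (R + t *\<^sub>R M) + g' M (R + t *\<^sub>R M) * f (R + t *\<^sub>R M)) (at t)" for R M t
    using * by (intro DERIV_mult)
  ultimately show ?case by (intro exI[of _ "\<lambda>M R. f' M R * g R + g' M R * f R"]) blast
qed

context
  fixes f :: "'a::real_normed_vector \<Rightarrow> real"
  assumes f: "real_polynomial_function f"
begin

lemma dir_deriv_gradient:
  obtains g where "dir_deriv f = g" "\<And>M. real_polynomial_function (g M)" "\<And>R. linear (\<lambda>M. g M R)"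
    "\<And>R M t. ((\<lambda>t. f (R + t *\<^sub>R M)) has_real_derivative g M (R + t *\<^sub>R M)) (at t)"
proof -
  obtain g where g: "\<And>M. real_polynomial_function (g M)" "\<And>R. linear (\<lambda>M. g M R)"
    "\<And>R M t. ((\<lambda>t. f (R + t *\<^sub>R M)) has_real_derivative g M (R + t *\<^sub>R M)) (at t)"
    using real_polynomial_function_has_gradient[OF f] by blast
  have "dir_deriv f M R = g M R" for M R
    unfolding dir_deriv_def using g(3)[of R M 0] by (intro DERIV_imp_deriv) simp
  then show ?thesis using that g by blast
qed

lemma real_polynomial_function_dir_deriv: "real_polynomial_function (dir_deriv f M)"
  using dir_deriv_gradient by metis

lemma linear_dir_deriv: "linear (\<lambda>M. dir_deriv f M R)"
  using dir_deriv_gradient by metis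

lemma has_real_derivative_dir_deriv:
  "((\<lambda>t. f (R + t *\<^sub>R M)) has_real_derivative dir_deriv f M (R + t *\<^sub>R M)) (at t)"
  using dir_deriv_gradient by metis

end

text \<open>
  Applied first to \<open>f\<close> and then to its derivative, this carries second derivatives along a
  line to another line; it serves at once for conjugation and for scaling.
\<close>
lemma dir_deriv_transport:
  assumes "real_polynomial_function f" "real_polynomial_function g"
    and eq: "\<And>t. f (R + t *\<^sub>R M) = c * g (R' + (t * a) *\<^sub>R M')"
  shows "dir_deriv f M (R + t *\<^sub>R M) = c * a * dir_deriv g M' (R' + (t * a) *\<^sub>R M')"
proof -
  have "((\<lambda>t. c * g (R' + (t * a) *\<^sub>R M')) has_real_derivative
      c * (dir_deriv g M' (R' + (t * a) *\<^sub>R M') * a)) (at t)"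
    by (intro DERIV_cmult DERIV_chain2[OF has_real_derivative_dir_deriv[OF assms(2)]])
       (auto intro!: derivative_eq_intros)
  then have "((\<lambda>t. f (R + t *\<^sub>R M)) has_real_derivative
      c * (dir_deriv g M' (R' + (t * a) *\<^sub>R M') * a)) (at t)"
    by (simp only: eq)
  from DERIV_unique[OF has_real_derivative_dir_deriv[OF assms(1)] this] show ?thesis by simp
qed

lemma dir_deriv_poly:
  assumes "real_polynomial_function f" and eq: "\<And>t. f (R + t *\<^sub>R M) = poly q t"
  shows "dir_deriv f M (R + t *\<^sub>R M) = poly (pderiv q) t"
proof -
  have "((\<lambda>t. f (R + t *\<^sub>R M)) has_real_derivative poly (pderiv q) t) (at t)"
    unfolding eq by (rule poly_DERIV)
  from DERIV_unique[OF has_real_derivative_dir_deriv[OF assms(1)] this] show ?thesis .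
qed

lemma matrix_eq_sum_entries:
  "(M :: real^'n^'m) = (\<Sum>i\<in>UNIV. \<Sum>j\<in>UNIV. M $ i $ j *\<^sub>R axis i (axis j 1))"
proof -
  have "(\<Sum>i\<in>UNIV. \<Sum>j\<in>UNIV. M $ i $ j *\<^sub>R axis i (axis j 1)) $ a $ b = M $ a $ b" for a b
  proof -
    have "(\<Sum>i\<in>UNIV. \<Sum>j\<in>UNIV. M $ i $ j *\<^sub>R axis i (axis j 1)) $ a $ b
        = (\<Sum>i\<in>UNIV. if i = a then \<Sum>j\<in>UNIV. if j = b then M $ i $ j else 0 else 0)"
      unfolding sum_component by (intro sum.cong refl) (auto simp: axis_def if_distrib[of "\<lambda>x. _ * x"] cong: if_cong)
    then show ?thesis by simp
  qed
  then show ?thesis by (simp add: vec_eq_iff)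
qed

lemma dir_deriv_eq_sum_entry_deriv:
  assumes "real_polynomial_function f"
  shows "dir_deriv f M R = (\<Sum>i\<in>UNIV. \<Sum>j\<in>UNIV. entry_deriv i j f R * M $ i $ j)"
proof -
  have "dir_deriv f M R
      = dir_deriv f (\<Sum>i\<in>UNIV. \<Sum>j\<in>UNIV. M $ i $ j *\<^sub>R axis i (axis j 1)) R"
    using matrix_eq_sum_entries[of M] by simp
  also have "\<dots> = (\<Sum>i\<in>UNIV. \<Sum>j\<in>UNIV. M $ i $ j * dir_deriv f (axis i (axis j 1)) R)"
    by (simp add: linear_sum[OF linear_dir_deriv[OF assms]] linear_scale[OF linear_dir_deriv[OF assms]])
  finally show ?thesis by (simp add: entry_deriv_eq_dir_deriv mult.commute)
qed

lemma real_polynomial_function_entry_deriv: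
  "real_polynomial_function f \<Longrightarrow> real_polynomial_function (entry_deriv i j f)"
  using real_polynomial_function_dir_deriv[of f "axis i (axis j 1)"]
  by (simp add: entry_deriv_eq_dir_deriv[abs_def])

lemma dir_deriv2_eq_sum_entry_deriv:
  assumes f: "real_polynomial_function f"
  shows "dir_deriv (dir_deriv f M) M R
     = (\<Sum>i\<in>UNIV. \<Sum>j\<in>UNIV. \<Sum>l\<in>UNIV. \<Sum>m\<in>UNIV.
          entry_deriv i j (entry_deriv l m f) R * M $ i $ j * M $ l $ m)"
proof -
  have "entry_deriv i j (dir_deriv f M) R
      = (\<Sum>l\<in>UNIV. \<Sum>m\<in>UNIV. entry_deriv i j (entry_deriv l m f) R * M $ l $ m)" for i j
  proof -
    have "((\<lambda>t. \<Sum>l\<in>UNIV. \<Sum>m\<in>UNIV. entry_deriv l m f (R + t *\<^sub>R axis i (axis j 1)) * M $ l $ m)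
      has_real_derivative (\<Sum>l\<in>UNIV. \<Sum>m\<in>UNIV.
         dir_deriv (entry_deriv l m f) (axis i (axis j 1)) (R + 0 *\<^sub>R axis i (axis j 1)) * M $ l $ m)) (at 0)"
      by (intro DERIV_sum DERIV_cmult_right has_real_derivative_dir_deriv
          real_polynomial_function_entry_deriv f)
    then show ?thesis
      unfolding entry_deriv_eq_dir_deriv[of i j] dir_deriv_def[of "dir_deriv f M"]
        dir_deriv_eq_sum_entry_deriv[OF f, of M]
      by (intro DERIV_imp_deriv) simp
  qed
  then show ?thesis
    unfolding dir_deriv_eq_sum_entry_deriv[OF real_polynomial_function_dir_deriv[OF f], of M M]
    by (simp add: sum_distrib_left sum_distrib_right mult_ac)
qed

lemma real_polynomial_function_S:
  assumes "k \<le> CARD('n)"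
  shows "real_polynomial_function (S k :: real^'n^'n \<Rightarrow> real)"
proof -
  have "real_polynomial_function (\<lambda>R :: real^'n^'n. R $ i $ j)" for i j
    by (intro real_polynomial_function.intros(1)
        bounded_linear_compose[OF bounded_linear_vec_nth bounded_linear_vec_nth])
  then have "real_polynomial_function
     (\<lambda>R :: real^'n^'n. \<Sum>I | card I = k. principal_minor I (\<lambda>i j. R $ i $ j))"
    unfolding principal_minor_def
    by (intro real_polynomial_function_sum real_polynomial_function.intros(4)
        real_polynomial_function.intros(2) real_polynomial_function_prod finite_permutations) auto
  moreover have "S k = (\<lambda>R :: real^'n^'n. \<Sum>I | card I = k. principal_minor I (\<lambda>i j. R $ i $ j))"
    using S_eq_sum_minors[OF assms] by (intro ext)
  ultimately show ?thesis by simp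
qed

text \<open>
  \<open>S k\<close> is positive near \<open>R\<close>, so that the inner derivative of \<open>F k = ln (S k)\<close> is the quotient
  \<open>dS / S\<close> in a neighbourhood of \<open>R\<close>, and the outer derivative follows from the quotient rule.
\<close>
lemma d2F_eq:
  fixes R M :: "real^'n^'n"
  assumes k: "k \<le> CARD('n)" and pos: "0 < S k R"
  shows "d2F k R M
     = (dir_deriv (dir_deriv (S k) M) M R * S k R - (dir_deriv (S k) M R)\<^sup>2) / (S k R)\<^sup>2"
proof -
  note S = real_polynomial_function_S[OF k]
  note dS = has_real_derivative_dir_deriv[OF S]
  have first: "entry_deriv l m (F k) Q = entry_deriv l m (S k) Q / S k Q"
    if "0 < S k Q" for l m and Q :: "real^'n^'n"
  proof -
    have "((\<lambda>t. ln (S k (Q + t *\<^sub>R axis l (axis m 1)))) has_real_derivative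
        inverse (S k (Q + 0 *\<^sub>R axis l (axis m 1))) *
        dir_deriv (S k) (axis l (axis m 1)) (Q + 0 *\<^sub>R axis l (axis m 1))) (at 0)"
      using that by (intro DERIV_chain2[OF DERIV_ln dS]) simp
    then show ?thesis
      unfolding entry_deriv_def[of l m "F k"] F_def entry_deriv_eq_dir_deriv[of l m "S k"]
      by (intro DERIV_imp_deriv) (simp add: divide_inverse mult.commute)
  qed
  have second: "entry_deriv i j (entry_deriv l m (F k)) R
     = (entry_deriv i j (entry_deriv l m (S k)) R * S k R
        - entry_deriv i j (S k) R * entry_deriv l m (S k) R) / (S k R)\<^sup>2" for i j l m
  proof -
    let ?E = "axis i (axis j 1) :: real^'n^'n"
    have "isCont (\<lambda>t. S k (R + t *\<^sub>R ?E)) 0" using dS DERIV_isCont by blast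
    then have "((\<lambda>t. S k (R + t *\<^sub>R ?E)) \<longlongrightarrow> S k (R + 0 *\<^sub>R ?E)) (nhds 0)"
      unfolding isCont_def by (rule tendsto_at_iff_tendsto_nhds[THEN iffD1])
    then have "((\<lambda>t. S k (R + t *\<^sub>R ?E)) \<longlongrightarrow> S k R) (nhds 0)" by simp
    then have "eventually (\<lambda>t. 0 < S k (R + t *\<^sub>R ?E)) (nhds 0)"
      using pos by (rule order_tendstoD)
    then have ev: "eventually (\<lambda>t. entry_deriv l m (F k) (R + t *\<^sub>R ?E)
        = entry_deriv l m (S k) (R + t *\<^sub>R ?E) / S k (R + t *\<^sub>R ?E)) (nhds 0)"
      by eventually_elim (rule first)
    have "((\<lambda>t. entry_deriv l m (S k) (R + t *\<^sub>R ?E) / S k (R + t *\<^sub>R ?E)) has_real_derivative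
       (dir_deriv (entry_deriv l m (S k)) ?E (R + 0 *\<^sub>R ?E) * S k (R + 0 *\<^sub>R ?E)
        - entry_deriv l m (S k) (R + 0 *\<^sub>R ?E) * dir_deriv (S k) ?E (R + 0 *\<^sub>R ?E))
        / (S k (R + 0 *\<^sub>R ?E) * S k (R + 0 *\<^sub>R ?E))) (at 0)"
      using pos by (intro DERIV_divide dS has_real_derivative_dir_deriv
          real_polynomial_function_entry_deriv S) simp
    then have "((\<lambda>t. entry_deriv l m (F k) (R + t *\<^sub>R ?E)) has_real_derivative
       (dir_deriv (entry_deriv l m (S k)) ?E (R + 0 *\<^sub>R ?E) * S k (R + 0 *\<^sub>R ?E)
        - entry_deriv l m (S k) (R + 0 *\<^sub>R ?E) * dir_deriv (S k) ?E (R + 0 *\<^sub>R ?E))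
        / (S k (R + 0 *\<^sub>R ?E) * S k (R + 0 *\<^sub>R ?E))) (at 0)"
      using DERIV_cong_ev[OF refl ev refl] by blast
    from DERIV_imp_deriv[OF this] show ?thesis
      unfolding entry_deriv_eq_dir_deriv[of i j] dir_deriv_def[of "entry_deriv l m (F k)"]
      by (simp add: power2_eq_square mult.commute)
  qed
  have "d2F k R M = (\<Sum>i\<in>UNIV. \<Sum>j\<in>UNIV. \<Sum>l\<in>UNIV. \<Sum>m\<in>UNIV.
      (entry_deriv i j (entry_deriv l m (S k)) R * M $ i $ j * M $ l $ m * S k R
        - entry_deriv i j (S k) R * M $ i $ j * (entry_deriv l m (S k) R * M $ l $ m)) / (S k R)\<^sup>2)"
    unfolding d2F_def second by (intro sum.cong refl) (simp add: algebra_simps)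
  also have "\<dots> = (dir_deriv (dir_deriv (S k) M) M R * S k R - (dir_deriv (S k) M R)\<^sup>2) / (S k R)\<^sup>2"
    unfolding dir_deriv2_eq_sum_entry_deriv[OF S] dir_deriv_eq_sum_entry_deriv[OF S] power2_eq_square[of "sum _ _"]
    by (simp only: sum_divide_distrib[symmetric] sum_subtractf sum_distrib_left[symmetric] sum_distrib_right[symmetric])
  finally show ?thesis .
qed

section \<open>Uniform negativity by compactness\<close>

text \<open>
  The numerator of \<open>d2F k R P\<close>. It is a polynomial in the entries of \<open>R\<close> and \<open>P\<close>, hence
  continuous everywhere, including where \<open>S k\<close> is not positive.
\<close>
definition newton_form :: "nat \<Rightarrow> real^'n^'n \<Rightarrow> real^'n^'n \<Rightarrow> real" where
  "newton_form k R P = dir_deriv (dir_deriv (S k) P) P R * S k R - (dir_deriv (S k) P R)\<^sup>2"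

lemma S_similar:
  fixes R R' B B' :: "real^'n^'n"
  assumes "B ** R = R' ** B" "B' ** B = mat 1"
  shows "S k R = S k R'"
  using charpoly_similar[OF assms] by (simp add: S_def eigvals_def)

lemma S_scale:
  assumes "k \<le> CARD('n)"
  shows "S k (c *\<^sub>R R) = c ^ k * S k (R :: real^'n^'n)"
  unfolding S_eq_sum_minors[OF assms] vector_scaleR_component real_scaleR_def principal_minor_scale
    sum_distrib_left by (intro sum.cong) auto

lemma continuous_on_S: "k \<le> CARD('n) \<Longrightarrow> continuous_on A (S k :: real^'n^'n \<Rightarrow> real)"
  by (simp add: continuous_at_imp_continuous_on continuous_real_polymonial_function real_polynomial_function_S)

lemma continuous_on_newton_form:
  assumes "k \<le> CARD('n)"
  shows "continuous_on A (\<lambda>(R, P :: real^'n^'n). newton_form k R P)"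
proof -
  have c: "continuous_on A (\<lambda>x. f (fst x))"
    if "real_polynomial_function f" for f :: "real^'n^'n \<Rightarrow> real" and A :: "((real^'n^'n) \<times> (real^'n^'n)) set"
  proof -
    have "continuous_on UNIV f"
      using continuous_real_polymonial_function[OF that] by (simp add: continuous_at_imp_continuous_on)
    then show ?thesis by (rule continuous_on_compose2[OF _ continuous_on_fst[OF continuous_on_id]]) simp
  qed
  note S = real_polynomial_function_S[OF assms]
  show ?thesis
    unfolding newton_form_def case_prod_beta dir_deriv2_eq_sum_entry_deriv[OF S]
      dir_deriv_eq_sum_entry_deriv[OF S]
    by (intro continuous_intros c real_polynomial_function_entry_deriv S)
qed

lemma S_diag_line:
  assumes "k \<le> CARD('n)"
  shows "S k (diag l + t *\<^sub>R P :: real^'n^'n) = poly (line_poly k (($) l) (\<lambda>i j. P $ i $ j)) t"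
  unfolding S_eq_sum_minors[OF assms] poly_line_poly
  by (intro sum.cong refl arg_cong2[of _ _ _ _ principal_minor]) (auto simp: diag_def fun_eq_iff)

lemma newton_form_diag_neg:
  fixes P :: "real^'n^'n"
  assumes k: "2 \<le> k" "k \<le> CARD('n)" and l: "\<And>i. 0 < l $ i"
    and P: "transpose P = P" "P \<noteq> 0"
  shows "0 < S k (diag l)" "newton_form k (diag l) P < 0"
proof -
  define q where "q = line_poly k (($) l) (\<lambda>i j. P $ i $ j)"
  note S = real_polynomial_function_S[OF k(2)]
  have line: "S k (diag l + t *\<^sub>R P) = poly q t" for t
    unfolding q_def by (rule S_diag_line[OF k(2)])
  note d1 = dir_deriv_poly[OF S line]
  note d2 = dir_deriv_poly[OF real_polynomial_function_dir_deriv[OF S] d1]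
  have "S k (diag l) = coeff q 0" "dir_deriv (S k) P (diag l) = coeff q 1"
    "dir_deriv (dir_deriv (S k) P) P (diag l) = 2 * coeff q 2"
    using line[of 0] d1[of 0] d2[of 0] by (simp_all add: poly_0_coeff_0 coeff_pderiv numeral_2_eq_2)
  moreover have "2 * coeff q 0 * coeff q 2 < (coeff q 1)\<^sup>2"
  proof -
    obtain a b where "P $ a $ b \<noteq> 0" using P(2) by (auto simp: vec_eq_iff)
    moreover have "P $ i $ j = P $ j $ i" for i j
      using arg_cong[OF P(1), of "\<lambda>A. A $ i $ j"] by (simp add: transpose_def)
    ultimately show ?thesis unfolding q_def using k l by (intro line_poly_newton_strict) auto
  qed
  moreover have "0 < coeff q 0"
    unfolding q_def coeff_0_line_poly using l k by (intro esym_pos) auto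
  ultimately show "0 < S k (diag l)" "newton_form k (diag l) P < 0"
    by (simp_all add: newton_form_def mult_ac)
qed

lemma continuous_on_diag: "continuous_on A (diag :: real^'n \<Rightarrow> real^'n^'n)"
proof -
  have "linear (diag :: real^'n \<Rightarrow> real^'n^'n)"
    by (auto simp: linear_iff diag_def vec_eq_iff)
  then show ?thesis by (simp add: linear_continuous_on linear_conv_bounded_linear)
qed

lemma compact_unit_symmetric: "compact {P :: real^'n^'n. transpose P = P \<and> norm P = 1}"
proof -
  have "linear (transpose :: real^'n^'n \<Rightarrow> real^'n^'n)"
    by (auto simp: linear_iff transpose_def vec_eq_iff)
  then have "closed {P :: real^'n^'n. transpose P = P}"
    by (intro closed_Collect_eq continuous_on_id linear_continuous_on)
      (simp add: linear_conv_bounded_linear)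
  then have "compact (sphere 0 1 \<inter> {P :: real^'n^'n. transpose P = P})"
    by (intro compact_Int_closed compact_sphere)
  moreover have "sphere 0 1 \<inter> {P :: real^'n^'n. transpose P = P} = {P. transpose P = P \<and> norm P = 1}"
    by auto
  ultimately show ?thesis by simp
qed

text \<open>
  After scaling, the spectra in question lie in the compact cube \<open>[\<gamma>, 1]^n\<close>, and the symmetric
  directions of norm one are compact as well. On this compact set of pairs the strictly negative
  quotient \<open>newton_form / S\<^sup>2\<close> is bounded away from zero, and the strict inequalities persist
  on a neighbourhood of uniform radius, which makes room for the perturbation \<open>B\<close>.
\<close>
lemma newton_form_uniformly_neg:
  assumes k: "2 \<le> k" "k \<le> CARD('n)" and g: "0 < \<gamma>"
  shows "\<exists>\<epsilon>>0. \<exists>c>0. \<forall>l B. \<forall>P :: real^'n^'n. (\<forall>i. \<gamma> \<le> l $ i \<and> l $ i \<le> 1) \<and> transpose P = P \<and>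
    norm P = 1 \<and> norm B < \<epsilon> \<longrightarrow>
    0 < S k (diag l + B) \<and> newton_form k (diag l + B) P \<le> - c * (S k (diag l + B))\<^sup>2"
proof -
  define K where "K = (\<lambda>(l, P). (diag l, P)) `
    (cbox ((\<chi> i. \<gamma>) :: real^'n) (\<chi> i. 1) \<times> {P :: real^'n^'n. transpose P = P \<and> norm P = 1})"
  have inK: "(diag l, P) \<in> K"
    if "\<forall>i. \<gamma> \<le> l $ i \<and> l $ i \<le> 1" "transpose P = P" "norm P = 1" for l and P :: "real^'n^'n"
    using that unfolding K_def by (force simp: mem_box_cart)
  have K: "0 < S k (fst x)" "newton_form k (fst x) (snd x) < 0" if "x \<in> K" for x
    using that g newton_form_diag_neg[OF k] unfolding K_def
    by (force simp: mem_box_cart intro: less_le_trans)+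
  have contS: "continuous_on A (\<lambda>x. S k (fst x))" for A :: "((real^'n^'n) \<times> (real^'n^'n)) set"
    by (rule continuous_on_compose2[OF continuous_on_S[OF k(2), where A = UNIV] continuous_on_fst[OF continuous_on_id]]) simp
  have contN: "continuous_on A (\<lambda>x. newton_form k (fst x) (snd x))" for A :: "((real^'n^'n) \<times> (real^'n^'n)) set"
    using continuous_on_newton_form[OF k(2), of A] by (simp add: case_prod_beta)
  have compK: "compact K"
    unfolding K_def case_prod_beta
    by (intro compact_continuous_image compact_Times compact_cbox compact_unit_symmetric
        continuous_on_Pair continuous_on_snd continuous_on_id
        continuous_on_compose2[OF continuous_on_diag[of UNIV] continuous_on_fst]) auto
  obtain c where c: "0 < c" "\<And>x. x \<in> K \<Longrightarrow> newton_form k (fst x) (snd x) < - c * (S k (fst x))\<^sup>2"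
  proof (cases "K = {}")
    case True
    then show ?thesis using that[of 1] by auto
  next
    case False
    have "continuous_on K (\<lambda>x. newton_form k (fst x) (snd x) / (S k (fst x))\<^sup>2)"
      using K by (intro continuous_on_divide contN continuous_on_power contS) force
    from continuous_attains_sup[OF compK False this] obtain z where z: "z \<in> K"
      "\<And>x. x \<in> K \<Longrightarrow> newton_form k (fst x) (snd x) / (S k (fst x))\<^sup>2
         \<le> newton_form k (fst z) (snd z) / (S k (fst z))\<^sup>2" by blast
    define d where "d = - (newton_form k (fst z) (snd z) / (S k (fst z))\<^sup>2)"
    have d: "0 < d" unfolding d_def using K[OF z(1)] by (simp add: divide_neg_pos)
    show ?thesis
    proof (rule that[of "d / 2"])
      show "newton_form k (fst x) (snd x) < - (d / 2) * (S k (fst x))\<^sup>2" if "x \<in> K" for x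
      proof -
        have "newton_form k (fst x) (snd x) / (S k (fst x))\<^sup>2 \<le> - d"
          using z(2)[OF that] by (simp add: d_def)
        also have "- d < - (d / 2)" using d by simp
        finally have "newton_form k (fst x) (snd x) / (S k (fst x))\<^sup>2 < - (d / 2)" .
        then show ?thesis using K(1)[OF that] by (simp add: pos_divide_less_eq)
      qed
    qed (use d in simp)
  qed
  define U :: "((real^'n^'n) \<times> (real^'n^'n)) set"
    where "U = {x. 0 < S k (fst x) \<and> newton_form k (fst x) (snd x) < - c * (S k (fst x))\<^sup>2}"
  have "open U"
    unfolding U_def by (intro open_Collect_conj open_Collect_less contS contN continuous_intros)
  moreover have "K \<subseteq> U" using K c by (auto simp: U_def)
  ultimately obtain \<epsilon> where e: "0 < \<epsilon>" "(\<Union>x\<in>K. ball x \<epsilon>) \<subseteq> U"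
    using compact_subset_open_imp_ball_epsilon_subset[OF compK] by metis
  show ?thesis
  proof (intro exI conjI allI impI)
    fix l :: "real^'n" and B P :: "real^'n^'n"
    assume *: "(\<forall>i. \<gamma> \<le> l $ i \<and> l $ i \<le> 1) \<and> transpose P = P \<and> norm P = 1 \<and> norm B < \<epsilon>"
    then have "(diag l, P) \<in> K" using inK by blast
    moreover have "(diag l + B, P) \<in> ball (diag l, P) \<epsilon>"
      using * by (simp add: dist_prod_def dist_norm)
    ultimately have "(diag l + B, P) \<in> U" using e(2) by blast
    then show "0 < S k (diag l + B)" "newton_form k (diag l + B) P \<le> - c * (S k (diag l + B))\<^sup>2"
      by (auto simp: U_def)
  qed (use e c in auto)
qed

lemma orthogonal_matrix_inv_eq_transpose:
  fixes C :: "real^'n^'n"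
  assumes "orthogonal_matrix C"
  shows "matrix_inv C = transpose C"
proof -
  have C: "C ** transpose C = mat 1" "transpose C ** C = mat 1"
    using assms by (auto simp: orthogonal_matrix_def)
  have inv: "C ** matrix_inv C = mat 1 \<and> matrix_inv C ** C = mat 1"
    unfolding matrix_inv_def by (rule someI[of _ "transpose C"]) (simp add: C)
  have "matrix_inv C = (transpose C ** C) ** matrix_inv C" by (simp add: C)
  also have "\<dots> = transpose C" unfolding matrix_mul_assoc[symmetric] using inv by simp
  finally show ?thesis .
qed

lemma norm_le_entry_bound:
  fixes A :: "real^'n^'n"
  assumes "\<And>i j. \<bar>A $ i $ j\<bar> \<le> b"
  shows "norm A \<le> (real CARD('n))\<^sup>2 * b"
proof -
  have "norm A \<le> (\<Sum>i\<in>UNIV. norm (A $ i))"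
    unfolding norm_vec_def by (rule L2_set_le_sum) simp
  also have "\<dots> \<le> (\<Sum>i\<in>(UNIV :: 'n set). real CARD('n) * b)"
  proof (rule sum_mono)
    fix i
    have "norm (A $ i) \<le> (\<Sum>j\<in>UNIV. \<bar>A $ i $ j\<bar>)" by (rule norm_le_l1_cart)
    also have "\<dots> \<le> real CARD('n) * b" using sum_mono[of UNIV "\<lambda>j. \<bar>A $ i $ j\<bar>" "\<lambda>j. b"] assms by simp
    finally show "norm (A $ i) \<le> real CARD('n) * b" .
  qed
  finally show ?thesis by (simp add: power2_eq_square mult.assoc)
qed

lemma symmetric_skew_decomposition_unique:
  fixes \<omega> \<beta> \<omega>' \<beta>' :: "real^'n^'n"
  assumes "\<omega> + \<beta> = \<omega>' + \<beta>'" "transpose \<omega> = \<omega>" "transpose \<beta> = - \<beta>" "transpose \<omega>' = \<omega>'" "transpose \<beta>' = - \<beta>'"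
  shows "\<omega> = \<omega>'" "\<beta> = \<beta>'"
proof -
  have "\<omega> $ i $ j = \<omega>' $ i $ j" for i j
  proof -
    have "\<omega> $ i $ j + \<beta> $ i $ j = \<omega>' $ i $ j + \<beta>' $ i $ j"
      "\<omega> $ j $ i + \<beta> $ j $ i = \<omega>' $ j $ i + \<beta>' $ j $ i"
      using arg_cong[OF assms(1), of "\<lambda>A. A $ i $ j"] arg_cong[OF assms(1), of "\<lambda>A. A $ j $ i"] by simp_all
    moreover have "\<omega> $ j $ i = \<omega> $ i $ j" "\<omega>' $ j $ i = \<omega>' $ i $ j"
      "\<beta> $ j $ i = - \<beta> $ i $ j" "\<beta>' $ j $ i = - \<beta>' $ i $ j"
      using assms(2-)[THEN arg_cong[of _ _ "\<lambda>A. A $ i $ j"]] by (simp_all add: transpose_def)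
    ultimately show ?thesis by linarith
  qed
  then show "\<omega> = \<omega>'" by (simp add: vec_eq_iff)
  then show "\<beta> = \<beta>'" using assms(1) by simp
qed

lemma range_eigvals_diagonalised:
  fixes C C' :: "real^'n^'n"
  assumes "C ** \<omega> = diag l ** C" "C' ** C = mat 1"
  shows "range (($) (eigvals \<omega>)) = range (\<lambda>i. complex_of_real (l $ i))"
proof -
  have "charpoly (diag l) = det (\<chi> i j. if i = j then [:- complex_of_real (l $ i), 1:] else 0)"
    unfolding charpoly_def by (rule arg_cong[of _ _ det]) (auto simp: vec_eq_iff diag_def)
  also have "\<dots> = (\<Prod>i\<in>UNIV. [:- complex_of_real (l $ i), 1:])"
    by (subst det_diagonal) simp_all
  finally have "(\<Prod>i\<in>UNIV. [:- (eigvals \<omega> $ i), 1:]) = (\<Prod>i\<in>UNIV. [:- complex_of_real (l $ i), 1:])"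
    using charpoly_similar[OF assms] charpoly_eigvals by metis
  then have "poly (\<Prod>i\<in>UNIV. [:- (eigvals \<omega> $ i), 1:]) z = 0 \<longleftrightarrow>
      poly (\<Prod>i\<in>UNIV. [:- complex_of_real (l $ i), 1:]) z = 0" for z by simp
  then have "(\<exists>i. z = eigvals \<omega> $ i) \<longleftrightarrow> (\<exists>i. z = complex_of_real (l $ i))" for z
    by (simp add: poly_prod)
  then show ?thesis by (auto simp: image_iff set_eq_iff)
qed

section \<open>Orthogonal conjugation and scaling\<close>

lemma norm_orthogonal_mult:
  fixes C :: "real^'n^'n"
  assumes "orthogonal_matrix C"
  shows "norm (C *v x) = norm x"
proof -
  have "orthogonal_transformation ((*v) C)"
    using assms by (simp add: orthogonal_transformation_matrix)
  then show ?thesis by (rule orthogonal_transformation_norm)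
qed

lemma onorm_orthogonal_conj_le:
  fixes C B :: "real^'n^'n"
  assumes "orthogonal_matrix C"
  shows "onorm ((*v) (C ** B ** transpose C)) \<le> onorm ((*v) B)"
proof (rule onorm_le)
  fix x
  have "norm ((C ** B ** transpose C) *v x) = norm (B *v (transpose C *v x))"
    by (simp only: matrix_vector_mul_assoc[symmetric] norm_orthogonal_mult[OF assms])
  also have "\<dots> \<le> onorm ((*v) B) * norm (transpose C *v x)"
    by (rule onorm) simp
  also have "norm (transpose C *v x) = norm x"
    using assms by (intro norm_orthogonal_mult) simp
  finally show "norm ((C ** B ** transpose C) *v x) \<le> onorm ((*v) B) * norm x" .
qed

lemma diag_mult_diag_entry:
  "(diag d ** M ** diag d) $ i $ j = d $ i * M $ i $ j * (d $ j :: real)"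
proof -
  have "(diag d ** M) $ a $ b = d $ a * M $ a $ b" for a b
  proof -
    have "(diag d ** M) $ a $ b = (\<Sum>k\<in>UNIV. if a = k then d $ a * M $ k $ b else 0)"
      unfolding matrix_matrix_mult_def diag_def vec_lambda_beta by (intro sum.cong) auto
    then show ?thesis by simp
  qed
  moreover have "(N ** diag d) $ a $ b = N $ a $ b * d $ b" for a b and N :: "real^'a^'a"
  proof -
    have "(N ** diag d) $ a $ b = (\<Sum>k\<in>UNIV. if k = b then N $ a $ k * d $ b else 0)"
      unfolding matrix_matrix_mult_def diag_def vec_lambda_beta by (intro sum.cong) auto
    then show ?thesis by simp
  qed
  ultimately show ?thesis by simp
qed

text \<open>
  The weights \<open>l powr (-1/2)\<close> on the two sides of each entry are at most \<open>b powr (-1/2)\<close> each.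
\<close>
lemma norm_P_tilde2_le:
  fixes P :: "real^'n^'n"
  assumes "0 < b" "\<And>i. b \<le> l $ i"
  shows "norm (P_tilde2 C l P) \<le> norm (P_tilde C P) / b"
proof -
  let ?d = "\<lambda>i. l $ i powr (-1/2)"
  have "norm (P_tilde2 C l P $ i $ j) \<le> norm (((1 / b) *\<^sub>R P_tilde C P) $ i $ j)" for i j
  proof -
    have le: "?d i \<le> b powr (-1/2)" for i
      using assms by (intro powr_mono2') auto
    have "?d i * ?d j \<le> b powr (-1/2) * b powr (-1/2)"
      by (intro mult_mono le) simp_all
    also have "\<dots> = 1 / b" using assms(1) by (simp add: powr_add[symmetric] powr_minus_divide)
    finally have "\<bar>P_tilde C P $ i $ j\<bar> * (?d i * ?d j) \<le> \<bar>P_tilde C P $ i $ j\<bar> * (1 / b)"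
      by (intro mult_left_mono) auto
    then show ?thesis
      using assms(1) unfolding P_tilde2_def diag_mult_diag_entry by (simp add: abs_mult mult_ac)
  qed
  then have "norm (P_tilde2 C l P) \<le> norm ((1 / b) *\<^sub>R P_tilde C P)"
    by (intro norm_le_componentwise_cart)
  then show ?thesis using assms(1) by simp
qed

text \<open>
  The decomposition into symmetric and skew parts is unique, so the bounds in the definitions of
  the sets concern the given \<open>\<omega>\<close> and \<open>\<beta>\<close>, and the entries of \<open>l\<close> are the eigenvalues
  of \<open>\<omega>\<close> in some order. The scale \<open>s\<close> is the largest of them.
\<close>
lemma D_gamma_set_spectrum:
  fixes \<omega> \<beta> C :: "real^'n^'n"
  assumes R: "\<omega> + \<beta> \<in> D_gamma_set \<delta> \<mu> \<gamma>"
    and \<omega>: "transpose \<omega> = \<omega>" and \<beta>: "transpose \<beta> = - \<beta>" and \<delta>: "0 \<le> \<delta>"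
    and diag: "C ** \<omega> = diag l ** C" and inv: "C' ** C = mat 1"
  obtains s where "0 < s" "\<And>i. \<gamma> * s \<le> l $ i" "\<And>i. l $ i \<le> s" "onorm ((*v) \<beta>) \<le> \<delta> * s"
proof -
  obtain \<omega>' \<beta>' l' where D: "\<omega> + \<beta> = \<omega>' + \<beta>'" "transpose \<omega>' = \<omega>'" "transpose \<beta>' = - \<beta>'"
    "\<omega>' + \<beta>' \<in> D_set \<delta> \<mu>" and l': "l' \<in> Sigma_cone \<gamma>" "eigvals \<omega>' = (\<chi> j. complex_of_real (l' $ j))"
    using R unfolding D_gamma_set_def by blast
  have eq1: "\<omega> = \<omega>'" using symmetric_skew_decomposition_unique(1)[OF D(1) \<omega> \<beta> D(2,3)] .
  obtain \<omega>'' \<beta>'' where E: "\<omega>' + \<beta>' = \<omega>'' + \<beta>''" "transpose \<omega>'' = \<omega>''" "transpose \<beta>'' = - \<beta>''"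
    "onorm ((*v) \<beta>'') \<le> \<mu>" "\<mu> \<le> \<delta> * lambda_min \<omega>''"
    using D(4) unfolding D_set_def by blast
  have sum: "\<omega> + \<beta> = \<omega>'' + \<beta>''" using D(1) E(1) by simp
  note eq2 = symmetric_skew_decomposition_unique[OF sum \<omega> \<beta> E(2,3)]
  have "range (\<lambda>i. complex_of_real (l' $ i)) = range (\<lambda>i. complex_of_real (l $ i))"
    using range_eigvals_diagonalised[OF diag inv] l'(2) eq1 by simp
  from arg_cong[OF this, of "image Re"] have rng: "range (\<lambda>i. l' $ i) = range (\<lambda>i. l $ i)"
    by (simp add: image_image)
  define s where "s = Max (range (\<lambda>i. l $ i))"
  have "\<gamma> * Max (range (\<lambda>i. l' $ i)) \<le> Min (range (\<lambda>i. l' $ i))"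
    using l'(1) unfolding Sigma_cone_def by blast
  then have l'': "\<gamma> * s \<le> Min (range (\<lambda>i. l $ i))" by (simp only: rng s_def)
  have lpos: "0 < l $ i" for i
  proof -
    have "l $ i \<in> range (\<lambda>i. l' $ i)" unfolding rng by blast
    then show ?thesis using l'(1) by (auto simp: Sigma_cone_def Gamma_cone_def)
  qed
  have le: "l $ i \<le> s" for i by (simp add: s_def)
  have "lambda_min \<omega> = Min (range (\<lambda>i. l $ i))"
    unfolding lambda_min_def rng[symmetric] using l'(2) eq1 by simp
  also have "\<dots> \<le> l $ i" for i by simp
  finally have min: "lambda_min \<omega> \<le> s" using le order_trans by blast
  show ?thesis
  proof (rule that[of s])
    show "0 < s" using lpos le less_le_trans by blast
    show "\<gamma> * s \<le> l $ i" for i by (rule order_trans[OF l'']) simp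
    show "onorm ((*v) \<beta>) \<le> \<delta> * s"
      using E(4,5) eq2 mult_left_mono[OF min \<delta>] by simp
  qed (rule le)
qed

lemma d2F_transport:
  fixes R P R' P' :: "real^'n^'n"
  assumes k: "k \<le> CARD('n)" and c: "0 < c" and pos: "0 < S k R'"
    and eq: "\<And>t. S k (R + t *\<^sub>R P) = c * S k (R' + (t * a) *\<^sub>R P')"
  shows "d2F k R P = a\<^sup>2 * (newton_form k R' P' / (S k R')\<^sup>2)"
proof -
  note S = real_polynomial_function_S[OF k]
  note d1 = dir_deriv_transport[OF S S eq]
  note d2 = dir_deriv_transport[OF real_polynomial_function_dir_deriv[OF S] real_polynomial_function_dir_deriv[OF S] d1]
  have e: "S k R = c * S k R'" "dir_deriv (S k) P R = c * a * dir_deriv (S k) P' R'"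
    "dir_deriv (dir_deriv (S k) P) P R = c * a * a * dir_deriv (dir_deriv (S k) P') P' R'"
    using eq[of 0] d1[of 0] d2[of 0] by simp_all
  then have posR: "0 < S k R" using c pos by simp
  then have "d2F k R P = (c\<^sup>2 * (a\<^sup>2 * newton_form k R' P')) / (c\<^sup>2 * (S k R')\<^sup>2)"
    unfolding d2F_eq[OF k posR] newton_form_def e by (simp add: power2_eq_square algebra_simps)
  then show ?thesis using c by simp
qed

lemma d2F_zero_direction: "d2F k R 0 = 0"
  by (simp add: d2F_def)

lemma matrix_matrix_add_rdistrib:
  fixes A B :: "'a::semiring_1^'n^'m"
  shows "(A + B) ** C = A ** C + B ** C"
  by (simp add: matrix_matrix_mult_def vec_eq_iff distrib_right sum.distrib)

lemma orthogonal_conj_affine: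
  fixes C :: "real^'n^'n"
  assumes "orthogonal_matrix C"
  shows "C ** (A + t *\<^sub>R B) = (C ** A ** transpose C + t *\<^sub>R (C ** B ** transpose C)) ** C"
proof -
  have C: "transpose C ** C = mat 1" using assms by (simp add: orthogonal_matrix_def)
  have "(C ** M ** transpose C) ** C = C ** M" for M
    by (simp only: matrix_mul_assoc[symmetric] C matrix_mul_rid)
  then show ?thesis
    by (simp add: matrix_add_ldistrib matrix_matrix_add_rdistrib matrix_scalar_ac scalar_matrix_assoc[symmetric])
qed

theorem proposition5p1:
  fixes k :: nat and \<gamma> :: real
  assumes "2 \<le> k" and "k \<le> CARD('n::finite) - 1"
    and "0 < \<gamma>" and "\<gamma> < 1" and "gamma_admissible CARD('n) k \<gamma>"
  shows "\<exists>\<delta>\<^sub>0. 0 < \<delta>\<^sub>0 \<and> \<delta>\<^sub>0 < 1 \<and>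
    (\<exists>C\<^sub>1\<^sub>0 > 0. \<forall>\<mu> > 0. \<forall>\<delta>. 0 < \<delta> \<and> \<delta> \<le> \<delta>\<^sub>0 \<longrightarrow>
      (\<forall>R \<in> D_gamma_set \<delta> \<mu> \<gamma>. \<forall>P :: real^'n^'n. transpose P = P \<longrightarrow>
        (\<forall>\<omega> \<beta> C l.
           R = \<omega> + \<beta> \<and> transpose \<omega> = \<omega> \<and> transpose \<beta> = - \<beta> \<and>
           orthogonal_matrix C \<and> \<omega> = matrix_inv C ** diag l ** C \<longrightarrow>
           d2F k R P \<le> - C\<^sub>1\<^sub>0 * (norm (P_tilde2 C l P))\<^sup>2)))"
proof -
  have k: "2 \<le> k" "k \<le> CARD('n)" using assms(1,2) by auto
  obtain \<epsilon> c where e: "0 < \<epsilon>" and c: "0 < c" and neg: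
    "\<And>l B. \<And>P :: real^'n^'n. (\<forall>i. \<gamma> \<le> l $ i \<and> l $ i \<le> 1) \<and> transpose P = P \<and> norm P = 1 \<and> norm B < \<epsilon> \<Longrightarrow>
      0 < S k (diag l + B) \<and> newton_form k (diag l + B) P \<le> - c * (S k (diag l + B))\<^sup>2"
    using newton_form_uniformly_neg[OF k assms(3)] by blast
  define N where "N = (real CARD('n))\<^sup>2"
  have N: "0 < N" by (simp add: N_def)
  \<comment> \<open>\<open>N\<close> times the largest absolute entry bounds the norm of a matrix; the entries of the scaled skew part are at most \<open>\<delta>\<close>.\<close>
  define \<delta>\<^sub>0 where "\<delta>\<^sub>0 = min (1 / 2) (\<epsilon> / (2 * N))"
  have d0: "0 < \<delta>\<^sub>0" "\<delta>\<^sub>0 < 1" "N * \<delta>\<^sub>0 < \<epsilon>"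
  proof -
    have "N * \<delta>\<^sub>0 \<le> N * (\<epsilon> / (2 * N))" using N by (intro mult_left_mono) (auto simp: \<delta>\<^sub>0_def)
    then show "N * \<delta>\<^sub>0 < \<epsilon>" using N e by simp
  qed (use e N in \<open>auto simp: \<delta>\<^sub>0_def\<close>)
  have main: "d2F k R P \<le> - (c * \<gamma>\<^sup>2) * (norm (P_tilde2 C l P))\<^sup>2"
    if \<delta>: "0 < \<delta>" "\<delta> \<le> \<delta>\<^sub>0" and R: "R \<in> D_gamma_set \<delta> \<mu> \<gamma>" and P: "transpose P = P"
      and dec: "R = \<omega> + \<beta>" "transpose \<omega> = \<omega>" "transpose \<beta> = - \<beta>"
      and C: "orthogonal_matrix C" and \<omega>: "\<omega> = matrix_inv C ** diag l ** C"
    for \<delta> \<mu> l and R P \<omega> \<beta> C :: "real^'n^'n"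
  proof -
    have CC: "C ** transpose C = mat 1" "transpose C ** C = mat 1"
      using C by (auto simp: orthogonal_matrix_def)
    have inv: "matrix_inv C = transpose C" using C by (rule orthogonal_matrix_inv_eq_transpose)
    have diag: "C ** \<omega> = diag l ** C"
      unfolding \<omega> inv by (simp add: matrix_mul_assoc CC)
    obtain s where s: "0 < s" "\<And>i. \<gamma> * s \<le> l $ i" "\<And>i. l $ i \<le> s" "onorm ((*v) \<beta>) \<le> \<delta> * s"
      using D_gamma_set_spectrum[OF R[unfolded dec(1)] dec(2,3) _ diag CC(2)] \<delta>(1) by auto
    define \<beta>' where "\<beta>' = C ** \<beta> ** transpose C"
    define P' where "P' = C ** P ** transpose C"
    define r where "r = norm P'"
    have Pt: "P_tilde C P = P'" by (simp add: P_tilde_def P'_def inv)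
    have Rt: "C ** R ** transpose C = diag l + \<beta>'"
      unfolding dec(1) \<beta>'_def matrix_add_ldistrib matrix_matrix_add_rdistrib diag
      by (simp add: matrix_mul_assoc[symmetric] CC)
    show ?thesis
    proof (cases "P' = 0")
      case True
      have "P = transpose C ** P' ** C"
        unfolding P'_def by (simp add: matrix_mul_assoc CC) (simp add: matrix_mul_assoc[symmetric] CC)
      then have "P = 0" using True by simp
      moreover have "norm (P_tilde2 C l P) \<le> 0"
        using norm_P_tilde2_le[of "\<gamma> * s" l C P] s(1,2) assms(3) Pt True by simp
      ultimately show ?thesis by (simp add: d2F_zero_direction)
    next
      case False
      then have r: "0 < r" by (simp add: r_def)
      define L where "L = (\<chi> i. l $ i / s)"
      define B where "B = (1 / s) *\<^sub>R \<beta>'"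
      define Q where "Q = (1 / r) *\<^sub>R P'"
      have "norm B < \<epsilon>"
      proof -
        have "\<bar>B $ i $ j\<bar> \<le> \<delta>\<^sub>0" for i j
        proof -
          have "\<bar>\<beta>' $ i $ j\<bar> \<le> onorm ((*v) \<beta>')" by (rule matrix_component_le_onorm)
          also have "\<dots> \<le> \<delta> * s"
            unfolding \<beta>'_def using onorm_orthogonal_conj_le[OF C] s(4) order_trans by blast
          also have "\<dots> \<le> \<delta>\<^sub>0 * s" using \<delta>(2) s(1) by simp
          finally show ?thesis using s(1) by (simp add: B_def abs_mult divide_le_eq)
        qed
        then have "norm B \<le> N * \<delta>\<^sub>0" unfolding N_def by (rule norm_le_entry_bound)
        then show ?thesis using d0(3) by simp
      qed
      moreover have "\<forall>i. \<gamma> \<le> L $ i \<and> L $ i \<le> 1"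
        using s by (simp add: L_def le_divide_eq divide_le_eq)
      moreover have "transpose Q = Q"
      proof -
        have tr: "transpose P' = P'"
          unfolding P'_def by (simp add: matrix_transpose_mul matrix_mul_assoc P)
        have "P' $ i $ j = P' $ j $ i" for i j
          using arg_cong[OF tr, of "\<lambda>A. A $ j $ i"] by (simp add: transpose_def)
        then show ?thesis by (simp add: Q_def transpose_def vec_eq_iff)
      qed
      moreover have "norm Q = 1" using r by (simp add: Q_def r_def)
      ultimately have SN: "0 < S k (diag L + B)"
        "newton_form k (diag L + B) Q \<le> - c * (S k (diag L + B))\<^sup>2"
        using neg by blast+
      have line: "S k (R + t *\<^sub>R P) = s ^ k * S k ((diag L + B) + (t * (r / s)) *\<^sub>R Q)" for t
      proof -
        have "S k (R + t *\<^sub>R P) = S k (diag l + \<beta>' + t *\<^sub>R P')"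
          using orthogonal_conj_affine[OF C, of R t P] CC(2)
          unfolding Rt P'_def[symmetric] by (rule S_similar)
        also have "diag l + \<beta>' + t *\<^sub>R P' = s *\<^sub>R ((diag L + B) + (t * (r / s)) *\<^sub>R Q)"
          using s(1) r by (simp add: L_def B_def Q_def diag_def vec_eq_iff algebra_simps)
        finally show ?thesis using S_scale[OF k(2)] by simp
      qed
      have "d2F k R P = (r / s)\<^sup>2 * (newton_form k (diag L + B) Q / (S k (diag L + B))\<^sup>2)"
        using k(2) _ SN(1) line by (rule d2F_transport) (use s(1) in simp)
      also have "\<dots> \<le> (r / s)\<^sup>2 * (- c)"
        using SN by (intro mult_left_mono) (simp_all add: divide_le_eq)
      also have "\<dots> \<le> - (c * \<gamma>\<^sup>2) * (norm (P_tilde2 C l P))\<^sup>2"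
      proof -
        have "norm (P_tilde2 C l P) \<le> r / (\<gamma> * s)"
          using norm_P_tilde2_le[of "\<gamma> * s" l C P] s(1,2) assms(3) by (simp add: Pt r_def)
        then have "(norm (P_tilde2 C l P))\<^sup>2 \<le> (r / (\<gamma> * s))\<^sup>2" by (intro power_mono) auto
        then have "c * \<gamma>\<^sup>2 * (norm (P_tilde2 C l P))\<^sup>2 \<le> c * \<gamma>\<^sup>2 * (r / (\<gamma> * s))\<^sup>2"
          using c by (intro mult_left_mono) auto
        also have "\<dots> = (r / s)\<^sup>2 * c" using assms(3) by (simp add: power_divide power_mult_distrib)
        finally show ?thesis by simp
      qed
      finally show ?thesis .
    qed
  qed
  have "0 < c * \<gamma>\<^sup>2" using c assms(3) by simp
  then show ?thesis using d0(1,2) main by blast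
qed

end
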